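(* Let $\beta>0$, $v_0>0$, $s_c>0$, $\alpha\in\mathbb{R}$, $\sigma_0\ge 0$, let $s_e>0$, let $v_e=V_{op}(s_e)>0$ be the corresponding equilibrium speed, and write $V_{op}'=V_{op}'(s_e)$. The stochastic car-following model $$dv_n(t)=\beta\left[V_{op}(s_n(t))-v_n(t)\right]dt+\sigma_0\sqrt{v_n(t)}\,dW_n(t)$$ is mean square stable (in the sense of linear string stability defined in the context) if $$\sigma_0^2\le \frac{4v_eV_{op}'}{\beta}\left(\beta-2V_{op}'\right).$$
   Context: Here $v_n$ is the speed of vehicle $n$, $s_n$ is the gap to its leader $n-1$, the $W_n$ are Wiener processes, and $V_{op}(s)=\frac{v_0}{2}\left[\tanh\left(\frac{s}{s_c}-\alpha\right)+\tanh\alpha\right]$. In the stationary situation all vehicles have speed $v_e$ and gap $s_e$, with $v_e=V_{op}(s_e)$. Write $\gamma=\frac{\sigma_0}{2\sqrt{v_e}}$. Linearization: with $\delta s_n=s_n-s_e$, $\delta v_n=v_n-v_e$ denoting small deviations from the stationary situation, first-order Taylor expansion gives $$d\,\delta v_n=-\beta\,\delta v_n\,dt+\beta V_{op}'\,\delta s_n\,dt+\gamma\,\delta v_n\,dW,\qquad d\,\delta s_n=(\delta v_{n-1}-\delta v_n)\,dt.$$ The linear stability method is the one used to derive conditions for long-wavelength instabilities of traffic flow. For perturbations of the form $\delta s_n=\mathcal{S}e^{i\omega n+\lambda t}$, $\delta v_n=\mathcal{M}e^{i\omega n+\lambda t}$ with constants $\mathcal{S},\mathcal{M}$ (so that $\delta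 v_{n-1}=e^{-i\omega}\delta v_n$), where $\omega$ is the wavenumber of the perturbation along the string of vehicles, this is written as the linear system $$dU(t)=F\,U(t)\,dt+G\,U(t)\,dW(t),\qquad U=\begin{pmatrix}\delta s_n\\ \delta v_n\end{pmatrix},\quad F=\begin{pmatrix}0&e^{-i\omega}-1\\ \beta V_{op}'&-\beta\end{pmatrix},\quad G=\begin{pmatrix}0&0\\0&\gamma\end{pmatrix}.$$ Mean square stability: the stochastic system is said to be mean square stable (asymptotically stochastically mean square stable) if the solution of this linear system satisfies $\lim_{t\to\infty}\mathbb{E}\left[\|U(t)\|^2\right]=0$.
   Formalization: The wavenumber ω ranges over all reals except multiples of 2π: for those the gap deviation δs_n is constant in time, so E‖U(t)‖² cannot tend to 0 when the initial gap deviation is non-zero, and the unrestricted claim fails. *)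

theory Defs
  imports "HOL-Probability.Probability"
begin

section \<open>Wiener processes\<close>

text \<open>
  Time is the half line \<open>t \<ge> 0\<close>. A filtration indexed by \<open>[0,\<infinity>)\<close> is regarded as one indexed by
  \<^typ>\<open>real\<close> by setting \<open>F t = F 0\<close> for negative \<open>t\<close>; nothing below depends on \<open>F t\<close> or \<open>W t\<close> for
  \<open>t < 0\<close>.
\<close>

locale wiener_process = prob_space M + filtration "space M" F
  for M :: "'a measure" and F :: "real \<Rightarrow> 'a measure" +
  fixes W :: "real \<Rightarrow> 'a \<Rightarrow> real"
  assumes subalgebra_F: "\<And>t. subalgebra M (F t)"
    and adapted_W: "\<And>t. 0 \<le> t \<Longrightarrow> W t \<in> borel_measurable (F t)"
    and start_W: "AE x in M. W 0 x = 0"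
    and increment_distr: "\<And>s t. 0 \<le> s \<Longrightarrow> s < t \<Longrightarrow>
      distributed M lborel (\<lambda>x. W t x - W s x) (normal_density 0 (sqrt (t - s)))"
    and increment_indep: "\<And>s t. 0 \<le> s \<Longrightarrow> s < t \<Longrightarrow>
      indep_set (sets (F s)) {(\<lambda>x. W t x - W s x) -` A \<inter> space M | A. A \<in> sets borel}"
    and continuous_W: "AE x in M. continuous_on {0..} (\<lambda>t. W t x)"


section \<open>The Ito integral\<close>

text \<open>
  A step process on \<open>[0,T]\<close> is \<open>\<Sum>i<n. \<xi> i \<cdot> 1\<^bsub>(p i, p (i+1)]\<^esub>\<close> with bounded,
  \<open>F (p i)\<close>-measurable coefficients \<open>\<xi> i\<close>.
\<close>

definition step_data ::
  "'a measure \<Rightarrow> (real \<Rightarrow> 'a measure) \<Rightarrow> real \<Rightarrow> nat \<Rightarrow> (nat \<Rightarrow> real) \<Rightarrow>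
   (nat \<Rightarrow> 'a \<Rightarrow> 'b::euclidean_space) \<Rightarrow> bool" where
  "step_data M F T n p \<xi> \<longleftrightarrow>
     0 \<le> p 0 \<and> p n \<le> T \<and> (\<forall>i<n. p i \<le> p (Suc i)) \<and>
     (\<forall>i<n. \<xi> i \<in> borel_measurable (F (p i)) \<and> (\<exists>C. \<forall>x\<in>space M. norm (\<xi> i x) \<le> C))"

definition step_process ::
  "nat \<Rightarrow> (nat \<Rightarrow> real) \<Rightarrow> (nat \<Rightarrow> 'a \<Rightarrow> 'b::euclidean_space) \<Rightarrow> real \<Rightarrow> 'a \<Rightarrow> 'b" where
  "step_process n p \<xi> t x = (\<Sum>i<n. indicator {p i<..p (Suc i)} t *\<^sub>R \<xi> i x)"

definition step_integral ::
  "(real \<Rightarrow> 'a \<Rightarrow> real) \<Rightarrow> nat \<Rightarrow> (nat \<Rightarrow> real) \<Rightarrow>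
   (nat \<Rightarrow> 'a \<Rightarrow> 'b::euclidean_space) \<Rightarrow> 'a \<Rightarrow> 'b" where
  "step_integral W n p \<xi> x = (\<Sum>i<n. (W (p (Suc i)) x - W (p i) x) *\<^sub>R \<xi> i x)"

definition square_integrable_adapted ::
  "'a measure \<Rightarrow> (real \<Rightarrow> 'a measure) \<Rightarrow> real \<Rightarrow> (real \<Rightarrow> 'a \<Rightarrow> 'b::euclidean_space) \<Rightarrow> bool" where
  "square_integrable_adapted M F T H \<longleftrightarrow>
     (\<lambda>(t, x). H t x) \<in> borel_measurable (restrict_space lborel {0..T} \<Otimes>\<^sub>M M) \<and>
     (\<forall>t\<in>{0..T}. H t \<in> borel_measurable (F t)) \<and>
     (\<integral>\<^sup>+ x. (\<integral>\<^sup>+ t\<in>{0..T}. ennreal ((norm (H t x))\<^sup>2) \<partial>lborel) \<partial>M) < \<infinity>"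

text \<open>
  \<open>I\<close> is a version of the Ito integral of \<open>H\<close> over \<open>[0,T]\<close>: the mean square limit of the
  integrals of step processes that approximate \<open>H\<close> in the mean square sense.
\<close>

definition is_ito_integral ::
  "'a measure \<Rightarrow> (real \<Rightarrow> 'a measure) \<Rightarrow> (real \<Rightarrow> 'a \<Rightarrow> real) \<Rightarrow> real \<Rightarrow>
   (real \<Rightarrow> 'a \<Rightarrow> 'b::euclidean_space) \<Rightarrow> ('a \<Rightarrow> 'b) \<Rightarrow> bool" where
  "is_ito_integral M F W T H I \<longleftrightarrow>
     square_integrable_adapted M F T H \<and> I \<in> borel_measurable M \<and>
     (\<exists>n p \<xi>. (\<forall>k. step_data M F T (n k) (p k) (\<xi> k)) \<and>
        ((\<lambda>k. \<integral>\<^sup>+ x. (\<integral>\<^sup>+ t\<in>{0..T}.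
            ennreal ((norm (H t x - step_process (n k) (p k) (\<xi> k) t x))\<^sup>2) \<partial>lborel) \<partial>M)
          \<longlonglongrightarrow> 0) \<and>
        ((\<lambda>k. \<integral>\<^sup>+ x. ennreal ((norm (I x - step_integral W (n k) (p k) (\<xi> k) x))\<^sup>2) \<partial>M)
          \<longlonglongrightarrow> 0))"


section \<open>Linear stochastic differential equations and mean square stability\<close>

text \<open>\<open>dU = A U dt + B U dW\<close> on \<open>[0,\<infinity>)\<close>, with square integrable, adapted, continuous solutions.\<close>

definition linear_sde_solution ::
  "'a measure \<Rightarrow> (real \<Rightarrow> 'a measure) \<Rightarrow> (real \<Rightarrow> 'a \<Rightarrow> real) \<Rightarrow>
   complex^2^2 \<Rightarrow> complex^2^2 \<Rightarrow> (real \<Rightarrow> 'a \<Rightarrow> complex^2) \<Rightarrow> bool" where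
  "linear_sde_solution M F W A B U \<longleftrightarrow>
     (AE x in M. continuous_on {0..} (\<lambda>t. U t x)) \<and>
     (\<forall>T\<ge>0. square_integrable_adapted M F T U) \<and>
     (\<forall>t\<ge>0. \<exists>I. is_ito_integral M F W t (\<lambda>r x. B *v U r x) I \<and>
        (AE x in M. U t x = U 0 x + (LINT r:{0..t}|lborel. A *v U r x) + I x))"

text \<open>
  The second moment is a nonnegative extended integral, so that its convergence to \<open>0\<close> cannot
  hold for lack of integrability.
\<close>

definition linear_mean_square_stable ::
  "'a measure \<Rightarrow> (real \<Rightarrow> 'a measure) \<Rightarrow> (real \<Rightarrow> 'a \<Rightarrow> real) \<Rightarrow>
   complex^2^2 \<Rightarrow> complex^2^2 \<Rightarrow> bool" where
  "linear_mean_square_stable M F W A B \<longleftrightarrow>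
     (\<forall>U. linear_sde_solution M F W A B U \<longrightarrow>
        ((\<lambda>t. \<integral>\<^sup>+ x. ennreal ((norm (U t x))\<^sup>2) \<partial>M) \<longlongrightarrow> 0) at_top)"


section \<open>Linear string stability of car-following models\<close>

text \<open>
  A car-following model \<open>dv\<^sub>n = a s\<^sub>n v\<^sub>n dt + b s\<^sub>n v\<^sub>n dW\<^sub>n\<close>, \<open>ds\<^sub>n = (v\<^sub>n\<^sub>-\<^sub>1 - v\<^sub>n) dt\<close> is given by its
  acceleration \<open>a\<close> and noise amplitude \<open>b\<close> as functions of gap and speed. The matrices below act
  on \<open>U = (\<delta>s\<^sub>n, \<delta>v\<^sub>n)\<close> and collect the terms of first order in the deviations from the stationary
  state \<open>(se, ve)\<close>; the zeroth order term \<open>b se ve\<close> of the noise is dropped, so the zero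
  perturbation is an equilibrium. For a wave with wavenumber \<open>\<omega>\<close> along the string,
  \<open>\<delta>v\<^sub>n\<^sub>-\<^sub>1 = exp (- \<i> \<omega>) \<delta>v\<^sub>n\<close>.
\<close>

definition drift_matrix ::
  "(real \<Rightarrow> real \<Rightarrow> real) \<Rightarrow> real \<Rightarrow> real \<Rightarrow> real \<Rightarrow> complex^2^2" where
  "drift_matrix a se ve \<omega> =
     vector [vector [0, exp (- (\<i> * complex_of_real \<omega>)) - 1],
             vector [complex_of_real (deriv (\<lambda>s. a s ve) se),
                     complex_of_real (deriv (\<lambda>v. a se v) ve)]]"

definition noise_matrix :: "(real \<Rightarrow> real \<Rightarrow> real) \<Rightarrow> real \<Rightarrow> real \<Rightarrow> complex^2^2" where
  "noise_matrix b se ve =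
     vector [vector [0, 0],
             vector [complex_of_real (deriv (\<lambda>s. b s ve) se),
                     complex_of_real (deriv (\<lambda>v. b se v) ve)]]"

text \<open>
  Wavenumbers in \<open>2\<pi>\<int>\<close> are excluded. They describe a uniform shift of all gaps and speeds, for
  which \<open>\<delta>s\<^sub>n\<close> is constant in time in every model: it leads to another stationary state.
\<close>

definition mean_square_stable ::
  "'a measure \<Rightarrow> (real \<Rightarrow> 'a measure) \<Rightarrow> (real \<Rightarrow> 'a \<Rightarrow> real) \<Rightarrow>
   (real \<Rightarrow> real \<Rightarrow> real) \<Rightarrow> (real \<Rightarrow> real \<Rightarrow> real) \<Rightarrow> real \<Rightarrow> real \<Rightarrow> bool" where
  "mean_square_stable M F W a b se ve \<longleftrightarrow>
     (\<forall>\<omega>. exp (\<i> * complex_of_real \<omega>) \<noteq> 1 \<longrightarrow>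
        linear_mean_square_stable M F W (drift_matrix a se ve \<omega>) (noise_matrix b se ve))"


section \<open>The stochastic optimal velocity model\<close>

definition V_op :: "real \<Rightarrow> real \<Rightarrow> real \<Rightarrow> real \<Rightarrow> real" where
  "V_op v0 sc \<alpha> s = v0 / 2 * (tanh (s / sc - \<alpha>) + tanh \<alpha>)"

definition acceleration :: "real \<Rightarrow> real \<Rightarrow> real \<Rightarrow> real \<Rightarrow> real \<Rightarrow> real \<Rightarrow> real" where
  "acceleration \<beta> v0 sc \<alpha> s v = \<beta> * (V_op v0 sc \<alpha> s - v)"

definition noise_amplitude :: "real \<Rightarrow> real \<Rightarrow> real \<Rightarrow> real" where
  "noise_amplitude \<sigma>0 s v = \<sigma>0 * sqrt v"

lemma V_op_differentiable: "V_op v0 sc \<alpha> field_differentiable at s" if "sc \<noteq> 0"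
proof -
  have "(V_op v0 sc \<alpha> has_real_derivative
      v0 / 2 * ((1 - (tanh (s / sc - \<alpha>))\<^sup>2) * (1 / sc))) (at s)"
    unfolding V_op_def using that by (auto intro!: derivative_eq_intros)
  then show ?thesis
    by (auto simp: field_differentiable_def)
qed

lemma drift_matrix_acceleration:
  assumes "sc \<noteq> 0"
  shows "drift_matrix (acceleration \<beta> v0 sc \<alpha>) se ve \<omega> =
     vector [vector [0, exp (- (\<i> * complex_of_real \<omega>)) - 1],
             vector [complex_of_real (\<beta> * deriv (V_op v0 sc \<alpha>) se), complex_of_real (- \<beta>)]]"
proof -
  have "((\<lambda>s. acceleration \<beta> v0 sc \<alpha> s ve) has_field_derivative
      \<beta> * deriv (V_op v0 sc \<alpha>) se) (at se)"
    unfolding acceleration_def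
    using V_op_differentiable[OF assms, THEN field_differentiable_derivI]
    by (auto intro!: derivative_eq_intros)
  moreover have "((\<lambda>v. acceleration \<beta> v0 sc \<alpha> se v) has_field_derivative - \<beta>) (at ve)"
    unfolding acceleration_def by (auto intro!: derivative_eq_intros)
  ultimately show ?thesis
    by (simp add: drift_matrix_def DERIV_imp_deriv)
qed

lemma noise_matrix_noise_amplitude:
  assumes "ve > 0"
  shows "noise_matrix (noise_amplitude \<sigma>0) se ve =
     vector [vector [0, 0], vector [0, complex_of_real (\<sigma>0 / (2 * sqrt ve))]]"
proof -
  have "((\<lambda>v. noise_amplitude \<sigma>0 se v) has_field_derivative \<sigma>0 / (2 * sqrt ve)) (at ve)"
    unfolding noise_amplitude_def using assms
    by (auto intro!: derivative_eq_intros simp: field_simps)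
  moreover have "deriv (\<lambda>s. noise_amplitude \<sigma>0 s ve) se = 0"
    unfolding noise_amplitude_def by simp
  ultimately show ?thesis
    by (simp add: noise_matrix_def DERIV_imp_deriv)
qed

end

theory Submission
  imports Defs
begin

text \<open>
  For a suitable positive definite Hermitian form \<open>V\<close> on \<open>\<complex>\<^sup>2\<close>, the second moment \<open>\<phi> t = E (V (U t))\<close> of a
  solution satisfies \<open>\<phi> t = \<phi> 0 + \<integral> E (LV (U r)) dr\<close> over \<open>[0,t]\<close>, where \<open>LV\<close> is the generator applied to \<open>V\<close>,
  and \<open>LV \<le> - c V\<close> with \<open>c > 0\<close>. So \<open>\<phi>\<close> is decreasing and \<open>\<phi> t (1 + c t) \<le> \<phi> 0\<close>, which tends to \<open>0\<close>.
  Writing \<open>V u = |L u|\<^sup>2\<close> with an invertible matrix \<open>L\<close> reduces the moment formula to the case of the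
  norm. There it follows, without Ito's formula, from the decomposition of the solution into a path
  that is differentiable in time and an Ito integral, by the Ito isometry and the martingale property.

  With \<open>k = V\<^sub>o\<^sub>p' se\<close> and \<open>z = exp (- \<i> \<omega>) - 1\<close>, the form is \<open>V (s, v) = p |s|\<^sup>2 + 2 Re (q s cnj v) + |v|\<^sup>2\<close>
  where \<open>q = k + p cnj z / \<beta>\<close> is chosen so that \<open>LV\<close> has no mixed term, and \<open>p\<close> is slightly larger than the
  critical value \<open>- \<beta> k / Re z\<close> at which the coefficient of \<open>|s|\<^sup>2\<close> in \<open>LV\<close> vanishes.
\<close>

section \<open>Square integrable functions\<close>

definition L2 :: "'x measure \<Rightarrow> ('x \<Rightarrow> 'b::euclidean_space) \<Rightarrow> bool" where
  "L2 N f \<longleftrightarrow> f \<in> borel_measurable N \<and> integrable N (\<lambda>x. (norm (f x))\<^sup>2)"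

text \<open>The value is extended, so it makes sense before integrability is known and matches the
  nonnegative integrals in \<open>is_ito_integral\<close> and
  \<open>linear_mean_square_stable\<close>.\<close>

definition msq :: "'x measure \<Rightarrow> ('x \<Rightarrow> 'b::euclidean_space) \<Rightarrow> ennreal" where
  "msq N f = (\<integral>\<^sup>+ x. ennreal ((norm (f x))\<^sup>2) \<partial>N)"

lemma L2_measurable[measurable_dest]: "L2 N f \<Longrightarrow> f \<in> borel_measurable N"
  by (simp add: L2_def)

lemma L2_integrable: "L2 N f \<Longrightarrow> integrable N (\<lambda>x. (norm (f x))\<^sup>2)"
  by (simp add: L2_def)

lemma L2_iff_msq: "L2 N f \<longleftrightarrow> f \<in> borel_measurable N \<and> msq N f < \<infinity>"
  by (auto simp: L2_def msq_def integrable_iff_bounded)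

lemma msq_eq: "L2 N f \<Longrightarrow> msq N f = ennreal (\<integral>x. (norm (f x))\<^sup>2 \<partial>N)"
  by (auto simp: L2_def msq_def intro!: nn_integral_eq_integral)

text \<open>The parallelogram law with the term for \<open>u - v\<close> dropped. It serves as
  triangle inequality without square roots of extended reals.\<close>

lemma msq_add_le:
  assumes [measurable]: "f \<in> borel_measurable N" "g \<in> borel_measurable N"
  shows "msq N (\<lambda>x. f x + g x) \<le> 2 * msq N f + 2 * msq N g"
proof -
  have "(norm (u + v))\<^sup>2 \<le> 2 * (norm u)\<^sup>2 + 2 * (norm v)\<^sup>2" for u v :: 'b
    using zero_le_power2[of "norm (u - v)"]
    by (simp add: power2_norm_eq_inner inner_simps inner_commute)
  then have "msq N (\<lambda>x. f x + g x) \<le> (\<integral>\<^sup>+ x. ennreal (2 * (norm (f x))\<^sup>2 + 2 * (norm (g x))\<^sup>2) \<partial>N)"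
    unfolding msq_def by (intro nn_integral_mono ennreal_leI)
  also have "\<dots> = 2 * msq N f + 2 * msq N g"
    unfolding msq_def
    by (subst nn_integral_cmult[symmetric], simp, subst nn_integral_cmult[symmetric], simp,
        subst nn_integral_add[symmetric], simp, simp,
        intro nn_integral_cong) (simp add: ennreal_plus ennreal_mult)
  finally show ?thesis .
qed

lemma L2_add: "L2 N f \<Longrightarrow> L2 N g \<Longrightarrow> L2 N (\<lambda>x. f x + g x)"
  using msq_add_le[of f N g]
  by (auto simp: L2_iff_msq ennreal_mult_less_top order_le_less_trans)

lemma L2_bounded_linear:
  assumes f: "bounded_linear f" and "L2 N g"
  shows "L2 N (\<lambda>x. f (g x))"
proof -
  note [measurable] = \<open>L2 N g\<close>[THEN L2_measurable]
    borel_measurable_continuous_onI[OF linear_continuous_on[OF f, of UNIV]]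
  obtain K where K: "norm (f x) \<le> norm x * K" for x
    using bounded_linear.bounded[OF f] by blast
  have "(norm (f x))\<^sup>2 \<le> K\<^sup>2 * (norm x)\<^sup>2" for x
    using power_mono[OF K norm_ge_zero, of x 2] by (simp add: power_mult_distrib mult.commute)
  then show ?thesis
    unfolding L2_def
    by (auto intro!: Bochner_Integration.integrable_bound
        [OF integrable_mult_right[OF \<open>L2 N g\<close>[THEN L2_integrable], of "K\<^sup>2"]])
qed

lemma L2_scaleR: "L2 N f \<Longrightarrow> L2 N (\<lambda>x. c *\<^sub>R f x)"
  by (rule L2_bounded_linear[OF bounded_linear_scaleR_right])

lemma L2_minus: "L2 N f \<Longrightarrow> L2 N (\<lambda>x. - f x)"
  using L2_scaleR[of N f "-1"] by simp

lemma L2_diff: "L2 N f \<Longrightarrow> L2 N g \<Longrightarrow> L2 N (\<lambda>x. f x - g x)"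
  using L2_add[OF _ L2_minus] by fastforce

lemma L2_sum: "(\<And>i. i \<in> J \<Longrightarrow> L2 N (f i)) \<Longrightarrow> L2 N (\<lambda>x. \<Sum>i\<in>J. f i x)"
  by (induction J rule: infinite_finite_induct) (auto intro: L2_add simp: L2_def[of N "\<lambda>_. 0"])

lemma L2_inner:
  fixes f g :: "_ \<Rightarrow> 'b::euclidean_space"
  assumes "L2 N f" "L2 N g"
  shows "integrable N (\<lambda>x. f x \<bullet> g x)"
proof (rule Bochner_Integration.integrable_bound)
  note [measurable] = assms[THEN L2_measurable]
  show "integrable N (\<lambda>x. (norm (f x))\<^sup>2 + (norm (g x))\<^sup>2)"
    using assms by (intro Bochner_Integration.integrable_add L2_integrable)
  show "(\<lambda>x. f x \<bullet> g x) \<in> borel_measurable N"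
    by measurable
  have "\<bar>u \<bullet> v\<bar> \<le> (norm u)\<^sup>2 + (norm v)\<^sup>2" for u v :: 'b
  proof -
    have "\<bar>u \<bullet> v\<bar> \<le> norm u * norm v" by (rule Cauchy_Schwarz_ineq2)
    also have "\<dots> \<le> (norm u)\<^sup>2 + (norm v)\<^sup>2"
      using sum_squares_bound[of "norm u" "norm v"] mult_nonneg_nonneg[OF norm_ge_zero[of u] norm_ge_zero[of v]]
      by (simp only: mult.assoc)
    finally show ?thesis .
  qed
  then show "AE x in N. norm (f x \<bullet> g x) \<le> norm ((norm (f x))\<^sup>2 + (norm (g x))\<^sup>2)"
    by auto
qed

lemma L2_integrable_norm:
  fixes f :: "_ \<Rightarrow> 'b::euclidean_space"
  assumes "finite_measure N" "L2 N f"
  shows "integrable N f"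
proof -
  interpret finite_measure N by fact
  have "norm u \<le> 1 + (norm u)\<^sup>2" for u :: 'b
    using sum_squares_bound[of "norm u" 1] norm_ge_zero[of u] by (simp only: one_power2)
  then show ?thesis
    using assms by (intro Bochner_Integration.integrable_bound
        [OF Bochner_Integration.integrable_add[OF integrable_const[of 1] L2_integrable[OF assms(2)]]])
      (auto intro: L2_measurable)
qed

text \<open>The integral of \<open>(norm (s *\<^sub>R f x + t *\<^sub>R g x))\<^sup>2\<close> is a
  nonnegative quadratic form in \<open>s\<close> and \<open>t\<close>, which forces the sign of its
  discriminant.\<close>

lemma L2_Cauchy_Schwarz:
  assumes "L2 N f" "L2 N g"
  shows "(\<integral>x. f x \<bullet> g x \<partial>N)\<^sup>2 \<le> (\<integral>x. (norm (f x))\<^sup>2 \<partial>N) * (\<integral>x. (norm (g x))\<^sup>2 \<partial>N)"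
proof -
  define a where "a = (\<integral>x. (norm (f x))\<^sup>2 \<partial>N)"
  define b where "b = (\<integral>x. (norm (g x))\<^sup>2 \<partial>N)"
  define c where "c = (\<integral>x. f x \<bullet> g x \<partial>N)"
  note [simp] = L2_integrable[OF assms(1)] L2_integrable[OF assms(2)] L2_inner[OF assms]
  have q: "0 \<le> s\<^sup>2 * a + 2 * s * t * c + t\<^sup>2 * b" for s t
  proof -
    have "(\<integral>x. (norm (s *\<^sub>R f x + t *\<^sub>R g x))\<^sup>2 \<partial>N)
        = (\<integral>x. s\<^sup>2 * (norm (f x))\<^sup>2 + 2 * s * t * (f x \<bullet> g x) + t\<^sup>2 * (norm (g x))\<^sup>2 \<partial>N)"
      by (intro Bochner_Integration.integral_cong refl)
        (simp only: power2_norm_eq_inner inner_simps inner_commute[of "g _" "f _"], simp add: power2_eq_square algebra_simps)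
    also have "\<dots> = s\<^sup>2 * a + 2 * s * t * c + t\<^sup>2 * b"
      unfolding a_def b_def c_def by simp
    finally show ?thesis
      by (metis (no_types, lifting) Bochner_Integration.integral_nonneg zero_le_power2)
  qed
  have "0 \<le> a" "0 \<le> b" by (auto simp: a_def b_def)
  have "c\<^sup>2 \<le> a * b"
  proof (cases "b = 0")
    case True
    show ?thesis
    proof (rule ccontr)
      assume "\<not> ?thesis"
      then have "c \<noteq> 0" using True by auto
      \<comment> \<open>With \<open>b = 0\<close> and \<open>s = 1\<close> the form is affine in
        \<open>t\<close>. At the chosen \<open>t\<close> its value is \<open>a - (a + 1)\<close>,
        which is negative.\<close>
      then show False
        using q[of 1 "- (a + 1) / (2 * c)"] True by (simp add: field_simps)
    qed
  next
    case False
    then have "0 < b" using \<open>0 \<le> b\<close> by simp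
    \<comment> \<open>The value of the form at \<open>s = b\<close>, \<open>t = - c\<close>; the
      positive factor \<open>b\<close> can then be cancelled.\<close>
    have "0 \<le> b * (a * b - c\<^sup>2)"
      using q[of b "-c"] by (simp add: power2_eq_square algebra_simps)
    then show ?thesis
      using \<open>0 < b\<close> by (simp add: zero_le_mult_iff)
  qed
  then show ?thesis by (simp add: a_def b_def c_def)
qed

text \<open>By Cauchy-Schwarz, testing against a fixed \<open>Y\<close> is continuous for mean
  square convergence.\<close>

lemma L2_inner_tendsto:
  assumes Y: "L2 N Y" and f: "L2 N f" and F: "\<And>k. L2 N (F k)"
    and lim: "(\<lambda>k. msq N (\<lambda>x. F k x - f x)) \<longlonglongrightarrow> 0"
  shows "(\<lambda>k. \<integral>x. Y x \<bullet> F k x \<partial>N) \<longlonglongrightarrow> (\<integral>x. Y x \<bullet> f x \<partial>N)"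
proof (rule LIM_zero_cancel)
  have D: "L2 N (\<lambda>x. F k x - f x)" for k using F f by (rule L2_diff)
  have "(\<lambda>k. \<integral>x. (norm (F k x - f x))\<^sup>2 \<partial>N) \<longlonglongrightarrow> 0"
    using lim by (subst (asm) msq_eq[OF D]) (simp flip: ennreal_0 add: tendsto_ennreal_iff)
  then have lim': "(\<lambda>k. sqrt ((\<integral>x. (norm (Y x))\<^sup>2 \<partial>N) * (\<integral>x. (norm (F k x - f x))\<^sup>2 \<partial>N))) \<longlonglongrightarrow> 0"
    by (auto intro!: tendsto_eq_intros)
  have bd: "norm ((\<integral>x. Y x \<bullet> F k x \<partial>N) - (\<integral>x. Y x \<bullet> f x \<partial>N))
      \<le> sqrt ((\<integral>x. (norm (Y x))\<^sup>2 \<partial>N) * (\<integral>x. (norm (F k x - f x))\<^sup>2 \<partial>N))" for k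
  proof -
    have "(\<integral>x. Y x \<bullet> F k x \<partial>N) - (\<integral>x. Y x \<bullet> f x \<partial>N) = (\<integral>x. Y x \<bullet> (F k x - f x) \<partial>N)"
      using L2_inner[OF Y F[of k]] L2_inner[OF Y f] by (simp add: inner_diff_right)
    then show ?thesis
      using real_sqrt_le_mono[OF L2_Cauchy_Schwarz[OF Y D[of k]]] by simp
  qed
  show "(\<lambda>k. (\<integral>x. Y x \<bullet> F k x \<partial>N) - (\<integral>x. Y x \<bullet> f x \<partial>N)) \<longlonglongrightarrow> 0"
    by (rule Lim_null_comparison[OF always_eventually[OF allI[OF bd]] lim'])
qed

text \<open>The squared norm of \<open>F k\<close> is twice its inner product with \<open>f\<close>,
  minus the squared norm of \<open>f\<close>, plus that of \<open>F k - f\<close>. The previous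
  lemma with \<open>Y = f\<close> handles the first term.\<close>

lemma L2_norm_tendsto:
  assumes f: "L2 N f" and F: "\<And>k. L2 N (F k)"
    and lim: "(\<lambda>k. msq N (\<lambda>x. F k x - f x)) \<longlonglongrightarrow> 0"
  shows "(\<lambda>k. \<integral>x. (norm (F k x))\<^sup>2 \<partial>N) \<longlonglongrightarrow> (\<integral>x. (norm (f x))\<^sup>2 \<partial>N)"
proof -
  have D: "L2 N (\<lambda>x. F k x - f x)" for k using F f by (rule L2_diff)
  have "(\<lambda>k. \<integral>x. (norm (F k x - f x))\<^sup>2 \<partial>N) \<longlonglongrightarrow> 0"
    using lim by (subst (asm) msq_eq[OF D]) (simp flip: ennreal_0 add: tendsto_ennreal_iff)
  from tendsto_add[OF tendsto_diff[OF tendsto_mult[OF tendsto_const[of 2] L2_inner_tendsto[OF f f F lim]]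
        tendsto_const[of "\<integral>x. (norm (f x))\<^sup>2 \<partial>N"]] this]
  have "(\<lambda>k. 2 * (\<integral>x. f x \<bullet> F k x \<partial>N) - (\<integral>x. (norm (f x))\<^sup>2 \<partial>N) + (\<integral>x. (norm (F k x - f x))\<^sup>2 \<partial>N))
     \<longlonglongrightarrow> (\<integral>x. (norm (f x))\<^sup>2 \<partial>N)"
    by (simp add: power2_norm_eq_inner)
  moreover have "2 * (\<integral>x. f x \<bullet> F k x \<partial>N) - (\<integral>x. (norm (f x))\<^sup>2 \<partial>N) + (\<integral>x. (norm (F k x - f x))\<^sup>2 \<partial>N)
     = (\<integral>x. (norm (F k x))\<^sup>2 \<partial>N)" for k
  proof -
    have "(\<integral>x. 2 * (f x \<bullet> F k x) - (norm (f x))\<^sup>2 + (norm (F k x - f x))\<^sup>2 \<partial>N)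
       = 2 * (\<integral>x. f x \<bullet> F k x \<partial>N) - (\<integral>x. (norm (f x))\<^sup>2 \<partial>N) + (\<integral>x. (norm (F k x - f x))\<^sup>2 \<partial>N)"
      using L2_inner[OF f F[of k]] L2_integrable[OF f] L2_integrable[OF D[of k]] by simp
    then show ?thesis
      by (simp add: power2_norm_eq_inner inner_simps inner_commute)
  qed
  ultimately show ?thesis by simp
qed

section \<open>Comparison and limits of mean squares\<close>

lemma L2_cong_AE:
  assumes "AE x in N. f x = h x" "f \<in> borel_measurable N" "L2 N h"
  shows "L2 N f"
proof -
  have "msq N f = msq N h"
    unfolding msq_def using assms(1) by (intro nn_integral_cong_AE) auto
  then show ?thesis using assms by (simp add: L2_iff_msq)
qed

lemma msq_minus_commute: "msq N (\<lambda>x. f x - g x) = msq N (\<lambda>x. g x - f x)"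
  by (simp add: msq_def norm_minus_commute)

text \<open>The constant is chosen before \<open>N\<close> and \<open>g\<close>, so one constant
  serves a whole sequence of approximations.\<close>

lemma msq_bounded_linear_le:
  assumes "bounded_linear f"
  obtains K where "0 < K" "\<And>N g. g \<in> borel_measurable N \<Longrightarrow> msq N (\<lambda>x. f (g x)) \<le> ennreal K * msq N g"
proof -
  obtain K where K: "0 < K" "norm (f x) \<le> norm x * K" for x
    using bounded_linear.pos_bounded[OF assms] by auto
  have "(norm (f x))\<^sup>2 \<le> K\<^sup>2 * (norm x)\<^sup>2" for x
    using power_mono[OF K(2) norm_ge_zero, of x 2] by (simp add: power_mult_distrib mult.commute)
  then have "msq N (\<lambda>x. f (g x)) \<le> ennreal (K\<^sup>2) * msq N g" if [measurable]: "g \<in> borel_measurable N" for N and g :: "'c \<Rightarrow> 'a"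
    unfolding msq_def
    by (subst nn_integral_cmult[symmetric]) (auto simp flip: ennreal_mult intro!: nn_integral_mono ennreal_leI)
  then show thesis using K(1) by (intro that[of "K\<^sup>2"]) auto
qed

text \<open>The factor \<open>c\<close> has to be finite, since multiplication in
  \<open>ennreal\<close> is not continuous at the pair of \<open>\<infinity>\<close> and
  \<open>0\<close>.\<close>

lemma ennreal_tendsto_0_le:
  fixes u v :: "nat \<Rightarrow> ennreal"
  assumes "v \<longlonglongrightarrow> 0" "\<And>k. u k \<le> c * v k" "c < \<infinity>"
  shows "u \<longlonglongrightarrow> 0"
proof (rule tendsto_sandwich[OF _ _ tendsto_const])
  show "(\<lambda>k. c * v k) \<longlonglongrightarrow> 0"
    using ennreal_tendsto_cmult[OF _ assms(1), of c] assms(3) by simp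
qed (use assms(2) in auto)

lemma msq_tendsto_0_triangle:
  assumes "\<And>k. f k \<in> borel_measurable N" "\<And>k. g k \<in> borel_measurable N" "\<And>k. h k \<in> borel_measurable N"
    and "(\<lambda>k. msq N (\<lambda>x. f k x - g k x)) \<longlonglongrightarrow> 0" "(\<lambda>k. msq N (\<lambda>x. g k x - h k x)) \<longlonglongrightarrow> 0"
  shows "(\<lambda>k. msq N (\<lambda>x. f k x - h k x)) \<longlonglongrightarrow> 0"
proof (rule ennreal_tendsto_0_le)
  show "(\<lambda>k. msq N (\<lambda>x. f k x - g k x) + msq N (\<lambda>x. g k x - h k x)) \<longlonglongrightarrow> 0"
    using tendsto_add[OF assms(4,5)] by simp
  show "msq N (\<lambda>x. f k x - h k x) \<le> 2 * (msq N (\<lambda>x. f k x - g k x) + msq N (\<lambda>x. g k x - h k x))" for k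
    using msq_add_le[of "\<lambda>x. f k x - g k x" N "\<lambda>x. g k x - h k x"] assms(1-3)
    by (simp add: distrib_left)
qed simp

text \<open>As a restricted space, time is a finite measure space, so products with \<open>M\<close>
  and Cauchy-Schwarz against constants apply on \<open>[0,T]\<close> without cutoffs in the
  integrands.\<close>

abbreviation leb :: "real \<Rightarrow> real measure" where
  "leb T \<equiv> restrict_space lborel {0..T}"

text \<open>Cauchy-Schwarz for \<open>norm (f x)\<close> against the constant
  \<open>1\<close>.\<close>

lemma norm_integral_power2_le:
  fixes f :: "'x \<Rightarrow> 'b::euclidean_space"
  assumes "finite_measure N" "L2 N f"
  shows "(norm (\<integral>x. f x \<partial>N))\<^sup>2 \<le> measure N (space N) * (\<integral>x. (norm (f x))\<^sup>2 \<partial>N)"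
proof -
  interpret finite_measure N by fact
  have n: "L2 N (\<lambda>x. norm (f x))" "L2 N (\<lambda>x. 1 :: real)"
    using assms(2) by (auto simp: L2_def)
  have "norm (\<integral>x. f x \<partial>N) \<le> (\<integral>x. 1 \<bullet> norm (f x) \<partial>N)"
    using integral_norm_bound[of N f] by simp
  then have "(norm (\<integral>x. f x \<partial>N))\<^sup>2 \<le> (\<integral>x. 1 \<bullet> norm (f x) \<partial>N)\<^sup>2"
    by (intro power_mono) auto
  also have "\<dots> \<le> measure N (space N) * (\<integral>x. (norm (f x))\<^sup>2 \<partial>N)"
    using L2_Cauchy_Schwarz[OF n(2,1)] by simp
  finally show ?thesis .
qed

lemma LINT_Icc_restrict:
  fixes f :: "real \<Rightarrow> 'b::euclidean_space"
  shows "(LINT r:{0..t}|lborel. f r) = (\<integral>r. f r \<partial>leb t)"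
  by (simp add: set_lebesgue_integral_def integral_restrict_space)

section \<open>Increments of a Wiener process\<close>

context wiener_process
begin

lemma measurable_F_imp_M: "f \<in> borel_measurable (F t) \<Longrightarrow> f \<in> borel_measurable M"
  by (rule measurable_from_subalg[OF subalgebra_F])

lemma measurable_F_mono: "f \<in> borel_measurable (F s) \<Longrightarrow> s \<le> t \<Longrightarrow> f \<in> borel_measurable (F t)"
  by (rule measurable_from_subalg[of _ "F s"]) (simp_all add: subalgebra_def space_F sets_F_mono)

lemma increment_measurable: "0 \<le> s \<Longrightarrow> s \<le> t \<Longrightarrow> (\<lambda>x. W t x - W s x) \<in> borel_measurable (F t)"
  by (intro borel_measurable_diff adapted_W measurable_F_mono[OF adapted_W]) auto

lemma increment_moments:
  assumes "0 \<le> s" "s \<le> t"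
  shows increment_L2: "L2 M (\<lambda>x. W t x - W s x)"
    and increment_mean: "(\<integral>x. W t x - W s x \<partial>M) = 0"
    and increment_variance: "(\<integral>x. (W t x - W s x)\<^sup>2 \<partial>M) = t - s"
proof -
  have "L2 M (\<lambda>x. W t x - W s x) \<and> (\<integral>x. W t x - W s x \<partial>M) = 0 \<and> (\<integral>x. (W t x - W s x)\<^sup>2 \<partial>M) = t - s"
  \<comment> \<open>The normal law of an increment is assumed only for \<open>s < t\<close>, so the
    trivial increment is treated separately.\<close>
  proof (cases "s = t")
    case True
    then show ?thesis by (simp add: L2_def)
  next
    case False
    then have st: "0 \<le> s" "s < t" using assms by auto
    note D = increment_distr[OF st]
    have pos: "0 < sqrt (t - s)" using st by simp
    have "integrable M (\<lambda>x. (W t x - W s x)\<^sup>2)"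
      using distributed_integrable[OF D, of "\<lambda>x. x\<^sup>2"] integrable_normal_moment[OF pos, of 0 2] by simp
    moreover have "(\<integral>x. W t x - W s x \<partial>M) = 0"
      by (rule normal_distributed_expectation[OF pos D])
    moreover have "(\<integral>x. (W t x - W s x)\<^sup>2 \<partial>M) = t - s"
      using normal_distributed_variance[OF pos D] calculation st by simp
    ultimately show ?thesis
      using measurable_F_imp_M[OF increment_measurable[OF assms]] by (simp add: L2_def)
  qed
  then show "L2 M (\<lambda>x. W t x - W s x)" "(\<integral>x. W t x - W s x \<partial>M) = 0"
    "(\<integral>x. (W t x - W s x)\<^sup>2 \<partial>M) = t - s" by auto
qed

text \<open>The preimages under \<open>Z\<close> form a subfamily of \<open>sets (F s)\<close>, so
  the assumed independence restricts to them. Families of preimages are stable under intersection,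
  so it then extends to the generated sigma-algebras.\<close>

lemma increment_indep_var:
  assumes "0 \<le> s" "s < t" and Z: "Z \<in> borel_measurable (F s)"
  shows "indep_var borel (Z :: 'a \<Rightarrow> real) borel (\<lambda>x. W t x - W s x)"
  unfolding indep_var_eq
proof (intro conjI indep_set_sigma_sets)
  let ?D = "\<lambda>x. W t x - W s x"
  show "random_variable borel Z" by (rule measurable_F_imp_M[OF Z])
  show "random_variable borel ?D"
    using assms by (intro measurable_F_imp_M[OF increment_measurable]) auto
  have "{Z -` A \<inter> space M |A. A \<in> sets borel} \<subseteq> sets (F s)"
    using measurable_sets[OF Z] by (auto simp: space_F)
  then show "indep_set {Z -` A \<inter> space M |A. A \<in> sets borel} {?D -` A \<inter> space M |A. A \<in> sets borel}"
    using increment_indep[OF assms(1,2)] unfolding indep_set_def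
    by (elim indep_sets_mono_sets) (auto split: bool.splits)
  have IS: "Int_stable {X -` A \<inter> space M |A. A \<in> sets borel}" for X :: "'a \<Rightarrow> real"
  proof (rule Int_stableI)
    fix a b assume "a \<in> {X -` A \<inter> space M |A. A \<in> sets borel}" "b \<in> {X -` A \<inter> space M |A. A \<in> sets borel}"
    then obtain A B where "a = X -` A \<inter> space M" "b = X -` B \<inter> space M" "A \<in> sets borel" "B \<in> sets borel"
      by auto
    then have "a \<inter> b = X -` (A \<inter> B) \<inter> space M" "A \<inter> B \<in> sets borel" by auto
    then show "a \<inter> b \<in> {X -` A \<inter> space M |A. A \<in> sets borel}" by blast
  qed
  show "Int_stable {Z -` A \<inter> space M |A. A \<in> sets borel}"
    "Int_stable {?D -` A \<inter> space M |A. A \<in> sets borel}" by (rule IS)+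
qed

text \<open>Independence factors the expectations. These are the first two conditional moments of an
  increment given the past, tested against a past variable \<open>Z\<close> in place of conditional
  expectations.\<close>

lemma increment_times:
  fixes Z :: "'a \<Rightarrow> real"
  assumes st: "0 \<le> s" "s \<le> t" and Z: "Z \<in> borel_measurable (F s)" "integrable M Z"
  shows increment_times_integrable: "integrable M (\<lambda>x. Z x * (W t x - W s x))"
    and increment_times_mean: "(\<integral>x. Z x * (W t x - W s x) \<partial>M) = 0"
    and increment_sq_times_integrable: "integrable M (\<lambda>x. Z x * (W t x - W s x)\<^sup>2)"
    and increment_sq_times_mean: "(\<integral>x. Z x * (W t x - W s x)\<^sup>2 \<partial>M) = (t - s) * (\<integral>x. Z x \<partial>M)"
proof -
  let ?D = "\<lambda>x. W t x - W s x"
  have "integrable M (\<lambda>x. Z x * ?D x) \<and> (\<integral>x. Z x * ?D x \<partial>M) = 0 \<and>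
    integrable M (\<lambda>x. Z x * (?D x)\<^sup>2) \<and> (\<integral>x. Z x * (?D x)\<^sup>2 \<partial>M) = (t - s) * (\<integral>x. Z x \<partial>M)"
  proof (cases "s = t")
    case False
    then have "s < t" using st by simp
    have ind: "indep_var borel Z borel ?D"
      by (rule increment_indep_var[OF st(1) \<open>s < t\<close> Z(1)])
    have ind2: "indep_var borel Z borel (\<lambda>x. (?D x)\<^sup>2)"
      using indep_var_compose[OF ind, of id borel "\<lambda>x. x\<^sup>2" borel] by (simp add: o_def)
    have i1: "integrable M ?D"
      using L2_integrable_norm[OF _ increment_L2[OF st]] finite_measure_axioms by blast
    have i2: "integrable M (\<lambda>x. (?D x)\<^sup>2)"
      using L2_integrable[OF increment_L2[OF st]] by simp
    show ?thesis
      using indep_var_integrable[OF ind Z(2) i1] indep_var_integrable[OF ind2 Z(2) i2]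
        indep_var_lebesgue_integral[OF ind Z(2) i1] indep_var_lebesgue_integral[OF ind2 Z(2) i2]
        increment_mean[OF st] increment_variance[OF st] by simp
  qed simp
  then show "integrable M (\<lambda>x. Z x * ?D x)" "(\<integral>x. Z x * ?D x \<partial>M) = 0"
    "integrable M (\<lambda>x. Z x * (?D x)\<^sup>2)" "(\<integral>x. Z x * (?D x)\<^sup>2 \<partial>M) = (t - s) * (\<integral>x. Z x \<partial>M)"
    by auto
qed

text \<open>The factor \<open>max 0 (min b d - c)\<close> is the length of the overlap of
  \<open>(a,b]\<close> and \<open>(c,d]\<close>. Since \<open>Z\<close> is known only at time
  \<open>c\<close>, it may depend on increments before \<open>c\<close>; hence the integrability
  hypothesis \<open>ZW\<close>.\<close>

lemma increment_product:
  fixes Z :: "'a \<Rightarrow> real"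
  assumes ord: "0 \<le> a" "a \<le> b" "a \<le> c" "c \<le> d" and Z: "Z \<in> borel_measurable (F c)" "integrable M Z"
    and ZW: "\<And>r. a \<le> r \<Longrightarrow> r \<le> c \<Longrightarrow> integrable M (\<lambda>x. Z x * (W r x - W a x))"
  shows "(\<integral>x. Z x * ((W b x - W a x) * (W d x - W c x)) \<partial>M) = max 0 (min b d - c) * (\<integral>x. Z x \<partial>M)"
proof (cases "b \<le> c")
  case True
  have "(\<lambda>x. Z x * (W b x - W a x)) \<in> borel_measurable (F c)"
    using ord True by (intro borel_measurable_times Z measurable_F_mono[OF increment_measurable]) auto
  from increment_times_mean[OF _ ord(4) this ZW[OF ord(2) True]] True ord
  show ?thesis by (simp add: mult.assoc)
next
  case False
  \<comment> \<open>The overlap is \<open>(c,m]\<close>, and \<open>M'\<close> is the later of the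
    two right ends.\<close>
  define m where "m = min b d"
  define M' where "M' = max b d"
  have m: "c \<le> m" "m \<le> M'" "0 \<le> c" "0 \<le> m" using False ord by (auto simp: m_def M'_def)
  have 1: "(\<lambda>x. Z x * (W c x - W a x)) \<in> borel_measurable (F c)"
    using ord by (intro borel_measurable_times Z increment_measurable) auto
  have 2: "(\<lambda>x. Z x * (W m x - W c x)) \<in> borel_measurable (F m)"
    using m by (intro borel_measurable_times measurable_F_mono[OF Z(1)] increment_measurable) auto
  note zc = ZW[OF ord(3) order_refl]
  note I = increment_times_integrable[OF m(3) ord(4) 1 zc]
    increment_sq_times_integrable[OF m(3,1) Z]
    increment_times_integrable[OF m(4,2) 2 increment_times_integrable[OF m(3,1) Z]]
  \<comment> \<open>In the first and the third term the last increment starts when everything else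
    is known, so both have mean zero after multiplication by \<open>Z\<close>. Only the square
    contributes.\<close>
  have "(W b x - W a x) * (W d x - W c x) = (W c x - W a x) * (W d x - W c x) + (W m x - W c x)\<^sup>2
     + (W m x - W c x) * (W M' x - W m x)" for x
    by (cases "b \<le> d") (auto simp: m_def M'_def power2_eq_square algebra_simps)
  then have "(\<integral>x. Z x * ((W b x - W a x) * (W d x - W c x)) \<partial>M) =
    (\<integral>x. Z x * (W c x - W a x) * (W d x - W c x) + Z x * (W m x - W c x)\<^sup>2
       + Z x * (W m x - W c x) * (W M' x - W m x) \<partial>M)"
    by (simp only: distrib_left mult.assoc)
  also have "\<dots> = (m - c) * (\<integral>x. Z x \<partial>M)"
    using I increment_times_mean[OF m(3) ord(4) 1 zc] increment_sq_times_mean[OF m(3,1) Z]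
      increment_times_mean[OF m(4,2) 2 increment_times_integrable[OF m(3,1) Z]]
    by simp
  finally show ?thesis using m(1) by (simp add: m_def)
qed

section \<open>Step processes\<close>

text \<open>
  The intervals \<open>(a j, b j]\<close> may overlap, so that differences of step processes over different
  partitions, and truncations in time, are again of this form.
\<close>

definition step_family ::
  "real \<Rightarrow> 'i set \<Rightarrow> ('i \<Rightarrow> real) \<Rightarrow> ('i \<Rightarrow> real) \<Rightarrow> ('i \<Rightarrow> 'a \<Rightarrow> 'b::euclidean_space) \<Rightarrow> bool" where
  "step_family T J a b \<xi> \<longleftrightarrow> finite J \<and> (\<forall>j\<in>J. 0 \<le> a j \<and> a j \<le> b j \<and> b j \<le> T \<and>
     \<xi> j \<in> borel_measurable (F (a j)) \<and> (\<exists>C. \<forall>x\<in>space M. norm (\<xi> j x) \<le> C))"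

definition family_process ::
  "'i set \<Rightarrow> ('i \<Rightarrow> real) \<Rightarrow> ('i \<Rightarrow> real) \<Rightarrow> ('i \<Rightarrow> 'a \<Rightarrow> 'b::euclidean_space) \<Rightarrow> real \<Rightarrow> 'a \<Rightarrow> 'b" where
  "family_process J a b \<xi> t x = (\<Sum>j\<in>J. indicator {a j<..b j} t *\<^sub>R \<xi> j x)"

definition family_integral ::
  "'i set \<Rightarrow> ('i \<Rightarrow> real) \<Rightarrow> ('i \<Rightarrow> real) \<Rightarrow> ('i \<Rightarrow> 'a \<Rightarrow> 'b::euclidean_space) \<Rightarrow> 'a \<Rightarrow> 'b" where
  "family_integral J a b \<xi> x = (\<Sum>j\<in>J. (W (b j) x - W (a j) x) *\<^sub>R \<xi> j x)"

definition time_space :: "real \<Rightarrow> (real \<times> 'a) measure" where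
  "time_space T = leb T \<Otimes>\<^sub>M M"

section \<open>Integrals of step families and their isometry\<close>

lemma step_familyD:
  assumes "step_family T J a b \<xi>"
  shows "finite J" "j \<in> J \<Longrightarrow> 0 \<le> a j" "j \<in> J \<Longrightarrow> a j \<le> b j" "j \<in> J \<Longrightarrow> b j \<le> T"
    "j \<in> J \<Longrightarrow> \<xi> j \<in> borel_measurable (F (a j))" "j \<in> J \<Longrightarrow> \<xi> j \<in> borel_measurable M"
    "j \<in> J \<Longrightarrow> \<exists>C. \<forall>x\<in>space M. norm (\<xi> j x) \<le> C"
  using assms measurable_F_imp_M by (auto simp: step_family_def)

lemma finite_measure_restrict_lborel: "finite_measure (leb T)"
  by (rule finite_measureI) (simp add: emeasure_restrict_space space_restrict_space emeasure_lborel_Icc_eq)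

lemma pair_sigma_finite_time: "pair_sigma_finite (leb T) M"
  using finite_measure_restrict_lborel[of T]
  by (intro pair_sigma_finite.intro finite_measure.axioms sigma_finite_measure_axioms)
    (auto simp: finite_measure_def)

text \<open>Tonelli. The right-hand side is the form in which the definitions measure processes; the
  left-hand side makes the lemmas on \<open>msq\<close> applicable to them.\<close>

lemma msq_time_space:
  assumes [measurable]: "(\<lambda>(t, x). H t x) \<in> borel_measurable (time_space T)"
  shows "msq (time_space T) (\<lambda>(t, x). H t x) =
    (\<integral>\<^sup>+ x. (\<integral>\<^sup>+ t\<in>{0..T}. ennreal ((norm (H t x))\<^sup>2) \<partial>lborel) \<partial>M)"
proof -
  interpret P: pair_sigma_finite "leb T" M by (rule pair_sigma_finite_time)
  note [measurable] = assms[unfolded time_space_def]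
  have "msq (time_space T) (\<lambda>(t, x). H t x) =
     (\<integral>\<^sup>+ x. (\<integral>\<^sup>+ t. ennreal ((norm (H t x))\<^sup>2) \<partial>leb T) \<partial>M)"
    unfolding msq_def time_space_def by (subst P.nn_integral_snd[symmetric]) (auto simp: split_beta')
  then show ?thesis
    by (simp add: nn_integral_restrict_space)
qed

lemma L2_bounded_times_increment:
  fixes \<xi> :: "'a \<Rightarrow> 'b::euclidean_space"
  assumes "0 \<le> s" "s \<le> t" and [measurable]: "\<xi> \<in> borel_measurable M" and "\<forall>x\<in>space M. norm (\<xi> x) \<le> C"
  shows "L2 M (\<lambda>x. (W t x - W s x) *\<^sub>R \<xi> x)"
  unfolding L2_def
proof
  note [measurable] = L2_measurable[OF increment_L2[OF assms(1,2)]]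
  show "(\<lambda>x. (W t x - W s x) *\<^sub>R \<xi> x) \<in> borel_measurable M" by measurable
  have "norm ((norm ((W t x - W s x) *\<^sub>R \<xi> x))\<^sup>2) \<le> norm (C\<^sup>2 * (norm (W t x - W s x))\<^sup>2)" if "x \<in> space M" for x
    using power_mono[of "norm (\<xi> x)" C 2] assms(4) that
    by (simp add: power_mult_distrib mult.commute[of "C\<^sup>2"] mult_left_mono)
  then show "integrable M (\<lambda>x. (norm ((W t x - W s x) *\<^sub>R \<xi> x))\<^sup>2)"
    by (intro Bochner_Integration.integrable_bound
        [OF integrable_mult_right[OF L2_integrable[OF increment_L2[OF assms(1,2)]], of "C\<^sup>2"]])
      (auto intro!: AE_I2)
qed

lemma L2_bounded:
  fixes \<xi> :: "'a \<Rightarrow> 'b::euclidean_space"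
  assumes [measurable]: "\<xi> \<in> borel_measurable M" and "\<forall>x\<in>space M. norm (\<xi> x) \<le> C"
  shows "L2 M \<xi>"
  unfolding L2_def using assms(2)
  by (auto intro!: integrable_const_bound[where B="C\<^sup>2"] AE_I2 power_mono)

lemma family_summand_L2:
  assumes fam: "step_family T J a b \<xi>" and j: "j \<in> J"
  shows "L2 M (\<lambda>x. (W (b j) x - W (a j) x) *\<^sub>R \<xi> j x)"
proof -
  obtain C where "\<forall>x\<in>space M. norm (\<xi> j x) \<le> C"
    using step_familyD(7)[OF fam j] by auto
  then show ?thesis
    using step_familyD[OF fam] j by (intro L2_bounded_times_increment) auto
qed

lemma family_integral_L2: "step_family T J a b \<xi> \<Longrightarrow> L2 M (family_integral J a b \<xi>)"
  unfolding family_integral_def by (intro L2_sum family_summand_L2)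

text \<open>The product of the two coefficients is known at the later of the two left ends, so it
  can be the \<open>Z\<close> of \<open>increment_product\<close>. Symmetry allows the assumption
  that \<open>k\<close> starts later.\<close>

lemma family_product:
  assumes fam: "step_family T J a b \<xi>" and j: "j \<in> J" and k: "k \<in> J"
  shows "(\<integral>x. ((W (b j) x - W (a j) x) *\<^sub>R \<xi> j x) \<bullet> ((W (b k) x - W (a k) x) *\<^sub>R \<xi> k x) \<partial>M)
    = max 0 (min (b j) (b k) - max (a j) (a k)) * (\<integral>x. \<xi> j x \<bullet> \<xi> k x \<partial>M)"
proof -
  have *: "(\<integral>x. ((W (b j) x - W (a j) x) *\<^sub>R \<xi> j x) \<bullet> ((W (b k) x - W (a k) x) *\<^sub>R \<xi> k x) \<partial>M)
    = max 0 (min (b j) (b k) - a k) * (\<integral>x. \<xi> j x \<bullet> \<xi> k x \<partial>M)"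
    if le: "a j \<le> a k" and j: "j \<in> J" and k: "k \<in> J" for j k
  proof -
    note J = step_familyD[OF fam]
    have Z: "(\<lambda>x. \<xi> j x \<bullet> \<xi> k x) \<in> borel_measurable (F (a k))"
      using J(5)[OF k] measurable_F_mono[OF J(5)[OF j] le] by simp
    obtain C1 where C1: "\<forall>x\<in>space M. norm (\<xi> j x) \<le> C1" using J(7)[OF j] by auto
    obtain C2 where C2: "\<forall>x\<in>space M. norm (\<xi> k x) \<le> C2" using J(7)[OF k] by auto
    have "\<bar>\<xi> j x \<bullet> \<xi> k x\<bar> \<le> C1 * C2" if "x \<in> space M" for x
    proof -
      have "norm (\<xi> j x) \<le> C1" "norm (\<xi> k x) \<le> C2" using C1 C2 that by auto
      then have "norm (\<xi> j x) * norm (\<xi> k x) \<le> C1 * C2"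
        by (intro mult_mono) (auto intro: order_trans[OF norm_ge_zero])
      then show ?thesis using Cauchy_Schwarz_ineq2[of "\<xi> j x" "\<xi> k x"] by simp
    qed
    then have Zb: "\<forall>x\<in>space M. norm (\<xi> j x \<bullet> \<xi> k x) \<le> C1 * C2" by simp
    have ZL: "L2 M (\<lambda>x. \<xi> j x \<bullet> \<xi> k x)"
      by (rule L2_bounded[OF measurable_F_imp_M[OF Z] Zb])
    have Zi: "integrable M (\<lambda>x. \<xi> j x \<bullet> \<xi> k x)"
      using L2_integrable_norm[OF _ ZL] finite_measure_axioms by blast
    have "integrable M (\<lambda>x. (\<xi> j x \<bullet> \<xi> k x) * (W r x - W (a j) x))" if "a j \<le> r" for r
      using L2_inner[OF ZL increment_L2[OF J(2)[OF j] that]] by simp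
    from increment_product[OF J(2)[OF j] J(3)[OF j] le J(3)[OF k] Z Zi this]
    show ?thesis by (simp add: ac_simps)
  qed
  show ?thesis
  proof (cases "a j \<le> a k")
    case True
    then show ?thesis using *[OF True j k] by (simp add: max_def)
  next
    case False
    then show ?thesis using *[of k j] j k by (simp add: max_def min.commute inner_commute)
  qed
qed

lemma family_process_measurable:
  assumes "step_family T J a b \<xi>"
  shows "(\<lambda>(t, x). family_process J a b \<xi> t x) \<in> borel_measurable (time_space S)"
proof -
  have "(\<lambda>(t, x). indicator {a j<..b j} t *\<^sub>R \<xi> j x) \<in> borel_measurable (time_space S)" if "j \<in> J" for j
  proof -
    note [measurable] = step_familyD(6)[OF assms that]
    have [measurable]: "indicator {a j<..b j} \<in> borel_measurable (leb S)"
      by (intro measurable_restrict_space1) simp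
    show ?thesis
      unfolding time_space_def by measurable
  qed
  then show ?thesis
    unfolding family_process_def split_beta' by (intro borel_measurable_sum) auto
qed

text \<open>Both sides equal the expectation of one double sum over pairs of intervals, weighted by
  the lengths of their overlaps.\<close>

lemma family_isometry:
  assumes fam: "step_family T J a b \<xi>"
  shows "msq (time_space T) (\<lambda>(t, x). family_process J a b \<xi> t x) = msq M (family_integral J a b \<xi>)"
proof -
  note J = step_familyD[OF fam]
  \<comment> \<open>For fixed \<open>x\<close> this is the time integral of the squared norm of the
    step process; in expectation it is also the squared norm of the integral.\<close>
  define G where "G x = (\<Sum>j\<in>J. \<Sum>k\<in>J. max 0 (min (b j) (b k) - max (a j) (a k)) * (\<xi> j x \<bullet> \<xi> k x))" for x
  have L2\<xi>: "L2 M (\<xi> j)" if "j \<in> J" for j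
    using J(6,7)[OF that] L2_bounded by metis
  have int: "integrable M (\<lambda>x. \<xi> j x \<bullet> \<xi> k x)" if "j \<in> J" "k \<in> J" for j k
    using L2_inner[OF L2\<xi>[OF that(1)] L2\<xi>[OF that(2)]] .
  have intG: "integrable M G"
    unfolding G_def by (intro Bochner_Integration.integrable_sum integrable_mult_right int)
  have "(\<integral>x. (norm (family_integral J a b \<xi> x))\<^sup>2 \<partial>M) = (\<integral>x. (\<Sum>j\<in>J. \<Sum>k\<in>J.
      ((W (b j) x - W (a j) x) *\<^sub>R \<xi> j x) \<bullet> ((W (b k) x - W (a k) x) *\<^sub>R \<xi> k x)) \<partial>M)"
    unfolding power2_norm_eq_inner family_integral_def inner_sum_left inner_sum_right
    by (subst sum.swap) simp
  also have "\<dots> = (\<integral>x. G x \<partial>M)"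
    unfolding G_def
    using L2_inner[OF family_summand_L2[OF fam] family_summand_L2[OF fam]] int family_product[OF fam]
    by simp
  finally have 1: "msq M (family_integral J a b \<xi>) = ennreal (\<integral>x. G x \<partial>M)"
    by (simp add: msq_eq[OF family_integral_L2[OF fam]])
  have 2: "(\<integral>\<^sup>+ t\<in>{0..T}. ennreal ((norm (family_process J a b \<xi> t x))\<^sup>2) \<partial>lborel) = ennreal (G x)" and "0 \<le> G x" for x
  proof -
    have ind: "indicator {a j<..b j} t * indicator {a k<..b k} t =
      (indicator {max (a j) (a k)<..min (b j) (b k)} t :: real)" for j k t
      by (auto simp: indicator_def)
    have eq: "(norm (family_process J a b \<xi> t x))\<^sup>2 = (\<Sum>j\<in>J. \<Sum>k\<in>J.
      indicator {max (a j) (a k)<..min (b j) (b k)} t * (\<xi> j x \<bullet> \<xi> k x))" for t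
      unfolding power2_norm_eq_inner family_process_def inner_sum_left inner_sum_right ind[symmetric]
      by (subst sum.swap) (simp add: ac_simps)
    have meas: "has_bochner_integral lborel (indicator {u<..v} :: real \<Rightarrow> real) (max 0 (v - u))" for u v :: real
    proof (cases "u \<le> v")
      case True
      then show ?thesis
        using has_bochner_integral_real_indicator[of "{u<..v}" lborel] by simp
    next
      case False
      then have "(indicator {u<..v} :: real \<Rightarrow> real) = (\<lambda>_. 0)"
        by (auto simp: indicator_def)
      then show ?thesis using False by (simp add: has_bochner_integral_zero)
    qed
    have hb: "has_bochner_integral lborel (\<lambda>t. (norm (family_process J a b \<xi> t x))\<^sup>2) (G x)"
      unfolding eq G_def
      by (intro has_bochner_integral_sum has_bochner_integral_mult_left meas)
    \<comment> \<open>All intervals lie in \<open>[0,T]\<close>, so the process vanishes outside and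
      the cutoff can be removed.\<close>
    have "(\<integral>\<^sup>+ t\<in>{0..T}. ennreal ((norm (family_process J a b \<xi> t x))\<^sup>2) \<partial>lborel)
      = (\<integral>\<^sup>+ t. ennreal ((norm (family_process J a b \<xi> t x))\<^sup>2) \<partial>lborel)"
    proof (intro nn_integral_cong)
      fix t
      show "ennreal ((norm (family_process J a b \<xi> t x))\<^sup>2) * indicator {0..T} t = ennreal ((norm (family_process J a b \<xi> t x))\<^sup>2)"
      proof (cases "t \<in> {0..T}")
        case False
        have "indicator {a j<..b j} t = (0::real)" if "j \<in> J" for j
          using J(2,4)[OF that] False by (auto simp: indicator_def)
        then have "family_process J a b \<xi> t x = 0" by (simp add: family_process_def)
        then show ?thesis by simp
      qed simp
    qed
    also have "\<dots> = ennreal (G x)"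
      using hb by (subst nn_integral_eq_integral) (auto simp: has_bochner_integral_iff)
    finally show "(\<integral>\<^sup>+ t\<in>{0..T}. ennreal ((norm (family_process J a b \<xi> t x))\<^sup>2) \<partial>lborel) = ennreal (G x)" .
    show "0 \<le> G x"
      using hb by (metis has_bochner_integral_integral_eq Bochner_Integration.integral_nonneg zero_le_power2)
  qed
  have "msq (time_space T) (\<lambda>(t, x). family_process J a b \<xi> t x) = (\<integral>\<^sup>+ x. ennreal (G x) \<partial>M)"
    unfolding msq_time_space[OF family_process_measurable[OF fam]] 2 ..
  also have "\<dots> = ennreal (\<integral>x. G x \<partial>M)"
    using intG \<open>\<And>x. 0 \<le> G x\<close> by (intro nn_integral_eq_integral) auto
  finally show ?thesis using 1 by simp
qed

text \<open>The difference is itself a family, indexed by the disjoint sum of the index sets with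
  the second coefficients negated, so the isometry applies to it.\<close>

lemma family_diff:
  assumes f1: "step_family T J1 a1 b1 \<xi>1" and f2: "step_family T J2 a2 b2 \<xi>2"
  shows "msq (time_space T) (\<lambda>(t, x). family_process J1 a1 b1 \<xi>1 t x - family_process J2 a2 b2 \<xi>2 t x)
    = msq M (\<lambda>x. family_integral J1 a1 b1 \<xi>1 x - family_integral J2 a2 b2 \<xi>2 x)"
proof -
  let ?J = "J1 <+> J2" and ?a = "case_sum a1 a2" and ?b = "case_sum b1 b2"
    and ?\<xi> = "case_sum \<xi>1 (\<lambda>j x. - \<xi>2 j x)"
  have fam: "step_family T ?J ?a ?b ?\<xi>"
    using f1 f2 by (auto simp: step_family_def)
  have "family_integral ?J ?a ?b ?\<xi> = (\<lambda>x. family_integral J1 a1 b1 \<xi>1 x - family_integral J2 a2 b2 \<xi>2 x)"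
    using step_familyD(1)[OF f1] step_familyD(1)[OF f2]
    by (simp add: fun_eq_iff family_integral_def sum.Plus sum_negf)
  moreover have "family_process ?J ?a ?b ?\<xi> = (\<lambda>t x. family_process J1 a1 b1 \<xi>1 t x - family_process J2 a2 b2 \<xi>2 t x)"
    using step_familyD(1)[OF f1] step_familyD(1)[OF f2]
    by (intro ext)
      (simp only: family_process_def sum.Plus o_def sum.case scaleR_minus_right sum_negf add_uminus_conv_diff)
  ultimately show ?thesis using family_isometry[OF fam] by simp
qed

text \<open>Intervals starting at \<open>r\<close> or later are dropped: for one starting after
  \<open>r\<close>, cutting at \<open>r\<close> would put the right end before the left end.\<close>

lemma family_truncate:
  assumes "step_family T J a b \<xi>" "0 \<le> r"
  shows "step_family r {j\<in>J. a j < r} a (\<lambda>j. min r (b j)) \<xi>"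
  using assms by (auto simp: step_family_def)

lemma family_process_truncate:
  assumes "finite J" "t \<le> r"
  shows "family_process {j\<in>J. a j < r} a (\<lambda>j. min r (b j)) \<xi> t x = family_process J a b \<xi> t x"
  unfolding family_process_def using assms
  by (intro sum.mono_neutral_cong_left) (auto simp: indicator_def)

text \<open>The martingale property, tested against a variable \<open>Y\<close> known at time
  \<open>r\<close>. Summands starting at \<open>r\<close> or later have mean zero against
  \<open>Y\<close>; those that cross \<open>r\<close> lose only the increment after
  \<open>r\<close>.\<close>

lemma family_integral_martingale:
  fixes Y :: "'a \<Rightarrow> 'b::euclidean_space"
  assumes fam: "step_family T J a b \<xi>" and "0 \<le> r" and Y: "Y \<in> borel_measurable (F r)" "L2 M Y"
  shows "(\<integral>x. Y x \<bullet> family_integral J a b \<xi> x \<partial>M) =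
    (\<integral>x. Y x \<bullet> family_integral {j\<in>J. a j < r} a (\<lambda>j. min r (b j)) \<xi> x \<partial>M)"
proof -
  note J = step_familyD[OF fam]
  let ?s = "\<lambda>j x. (W (b j) x - W (a j) x) *\<^sub>R \<xi> j x"
  let ?s' = "\<lambda>j x. (W (min r (b j)) x - W (a j) x) *\<^sub>R \<xi> j x"
  have fam': "step_family r {j\<in>J. a j < r} a (\<lambda>j. min r (b j)) \<xi>"
    by (rule family_truncate[OF fam \<open>0 \<le> r\<close>])
  have Y\<xi>: "integrable M (\<lambda>x. Y x \<bullet> \<xi> j x)" if "j \<in> J" for j
    using J(6,7)[OF that] L2_bounded L2_inner[OF Y(2)] by metis
  have Ym: "Y \<in> borel_measurable (F c)" if "r \<le> c" for c
    using measurable_F_mono[OF Y(1) that] .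
  have 1: "(\<integral>x. Y x \<bullet> ?s j x \<partial>M) = 0" if j: "j \<in> J" and "\<not> a j < r" for j
  proof -
    have "(\<lambda>x. Y x \<bullet> \<xi> j x) \<in> borel_measurable (F (a j))"
      using Ym[of "a j"] J(5)[OF j] that by simp
    from increment_times_mean[OF J(2,3)[OF j] this Y\<xi>[OF j]] show ?thesis by (simp add: ac_simps)
  qed
  have 2: "(\<integral>x. Y x \<bullet> ?s j x \<partial>M) = (\<integral>x. Y x \<bullet> ?s' j x \<partial>M)" if j: "j \<in> J" and "a j < r" for j
  proof (cases "b j \<le> r")
    case False
    have m: "(\<lambda>x. Y x \<bullet> \<xi> j x) \<in> borel_measurable (F r)"
      using Y(1) measurable_F_mono[OF J(5)[OF j], of r] that by simp
    have "r \<le> b j" using False by simp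
    have "L2 M (?s' j)"
      using family_summand_L2[OF fam', of j] that by simp
    then have i: "integrable M (\<lambda>x. Y x \<bullet> ?s' j x)"
      by (rule L2_inner[OF Y(2)])
    have "(\<integral>x. Y x \<bullet> ?s j x \<partial>M) = (\<integral>x. Y x \<bullet> ?s' j x + (Y x \<bullet> \<xi> j x) * (W (b j) x - W r x) \<partial>M)"
      using False by (intro Bochner_Integration.integral_cong) (auto simp: algebra_simps inner_simps)
    also have "\<dots> = (\<integral>x. Y x \<bullet> ?s' j x \<partial>M)"
      using increment_times_integrable[OF \<open>0 \<le> r\<close> \<open>r \<le> b j\<close> m Y\<xi>[OF j]]
        increment_times_mean[OF \<open>0 \<le> r\<close> \<open>r \<le> b j\<close> m Y\<xi>[OF j]] i by simp
    finally show ?thesis .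
  qed (simp add: min_def)
  have "(\<integral>x. Y x \<bullet> family_integral J a b \<xi> x \<partial>M) = (\<Sum>j\<in>J. \<integral>x. Y x \<bullet> ?s j x \<partial>M)"
    unfolding family_integral_def inner_sum_right
    by (intro Bochner_Integration.integral_sum L2_inner Y family_summand_L2[OF fam])
  also have "\<dots> = (\<Sum>j\<in>{j\<in>J. a j < r}. \<integral>x. Y x \<bullet> ?s' j x \<partial>M)"
    using 1 2 J(1) by (intro sum.mono_neutral_cong_right) auto
  also have "\<dots> = (\<integral>x. Y x \<bullet> family_integral {j\<in>J. a j < r} a (\<lambda>j. min r (b j)) \<xi> x \<partial>M)"
    unfolding family_integral_def inner_sum_right
    by (intro Bochner_Integration.integral_sum[symmetric] L2_inner Y family_summand_L2[OF fam'])
  finally show ?thesis .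
qed

section \<open>Slices and paths of processes\<close>

lemma slice_measurable:
  assumes "(\<lambda>(r, x). f r x :: 'b::euclidean_space) \<in> borel_measurable (time_space T)" "r \<in> {0..T}"
  shows "f r \<in> borel_measurable M"
  using measurable_Pair2[OF assms(1)[unfolded time_space_def], of r] assms(2)
  by (simp add: space_restrict_space)

lemma path_measurable:
  assumes "(\<lambda>(r, x). f r x :: 'b::euclidean_space) \<in> borel_measurable (time_space T)" "x \<in> space M"
  shows "(\<lambda>r. f r x) \<in> borel_measurable (leb T)"
  using measurable_Pair1[OF assms(1)[unfolded time_space_def], of x] assms(2)
  by simp

lemma AE_L2_slice:
  assumes "L2 (time_space T) (\<lambda>(r, x). f r x :: 'b::euclidean_space)"
  shows "AE r in leb T. L2 M (f r)"
proof -
  interpret P: pair_sigma_finite "leb T" M by (rule pair_sigma_finite_time)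
  have "integrable (leb T \<Otimes>\<^sub>M M) (\<lambda>(r, x). (norm (f r x))\<^sup>2)"
    using L2_integrable[OF assms] by (simp add: time_space_def split_beta')
  from P.AE_integrable_fst[OF this] show ?thesis
    using AE_space[of "leb T"]
    by eventually_elim
      (auto simp: L2_def space_restrict_space intro: slice_measurable[OF L2_measurable[OF assms]])
qed

lemma AE_L2_path:
  assumes "L2 (time_space T) (\<lambda>(r, x). f r x :: 'b::euclidean_space)"
  shows "AE x in M. L2 (leb T) (\<lambda>r. f r x)"
proof -
  interpret P: pair_sigma_finite "leb T" M by (rule pair_sigma_finite_time)
  have "integrable (leb T \<Otimes>\<^sub>M M) (\<lambda>(r, x). (norm (f r x))\<^sup>2)"
    using L2_integrable[OF assms] by (simp add: time_space_def split_beta')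
  from P.AE_integrable_snd[OF this] show ?thesis
    using AE_space[of M]
    by eventually_elim
      (auto simp: L2_def intro: path_measurable[OF L2_measurable[OF assms]])
qed

text \<open>Regards a random variable as a process constant in time, so that Fubini applies to
  products such as \<open>a r x \<bullet> I T x\<close> with \<open>T\<close> fixed.\<close>

lemma L2_const_time:
  assumes "L2 M (f :: 'a \<Rightarrow> 'b::euclidean_space)"
  shows "L2 (time_space T) (\<lambda>(r, x). f x)"
  unfolding L2_iff_msq
proof
  interpret P: pair_sigma_finite "leb T" M by (rule pair_sigma_finite_time)
  note [measurable] = L2_measurable[OF assms]
  show m: "(\<lambda>(r, x). f x) \<in> borel_measurable (time_space T)"
    unfolding time_space_def by measurable
  have "msq (time_space T) (\<lambda>(r, x). f x) = (\<integral>\<^sup>+ r. msq M f \<partial>leb T)"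
    using m unfolding msq_def time_space_def
    by (subst nn_integral_fst[symmetric]) (auto simp: split_beta')
  also have "\<dots> < \<infinity>"
    using assms by (auto simp: L2_iff_msq emeasure_restrict_space space_restrict_space ennreal_mult_less_top
        emeasure_lborel_Icc_eq)
  finally show "msq (time_space T) (\<lambda>(r, x). f x) < \<infinity>" .
qed

lemma time_inner_integrable:
  assumes "L2 (time_space T) (\<lambda>(r, x). f r x :: 'b::euclidean_space)" "L2 (time_space T) (\<lambda>(r, x). h r x)"
  shows "integrable (leb T \<Otimes>\<^sub>M M) (\<lambda>(r, x). f r x \<bullet> h r x)"
  using L2_inner[OF assms] by (simp add: time_space_def split_beta')

section \<open>Ito integrals\<close>

lemma step_data_family:
  assumes "step_data M F T n p \<xi>"
  shows "step_family T {..<n} p (\<lambda>i. p (Suc i)) \<xi>"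
proof -
  have le: "\<And>i. i < n \<Longrightarrow> p i \<le> p (Suc i)" and "0 \<le> p 0" "p n \<le> T"
    using assms by (auto simp: step_data_def)
  have "0 \<le> p i" if "i \<le> n" for i
    using that by (induction i) (use le \<open>0 \<le> p 0\<close> in \<open>auto intro: order_trans\<close>)
  moreover have "p i \<le> T" if "i \<le> n" for i
    using that by (induction rule: inc_induct) (use le \<open>p n \<le> T\<close> in \<open>auto intro: order_trans\<close>)
  ultimately show ?thesis
    using assms by (auto simp: step_family_def step_data_def)
qed

lemma step_process_eq: "step_process n p \<xi> = family_process {..<n} p (\<lambda>i. p (Suc i)) \<xi>"
  by (simp add: fun_eq_iff step_process_def family_process_def)

lemma step_integral_eq: "step_integral W n p \<xi> = family_integral {..<n} p (\<lambda>i. p (Suc i)) \<xi>"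
  by (simp add: fun_eq_iff step_integral_def family_integral_def)

lemma step_process_measurable:
  "step_data M F T n p \<xi> \<Longrightarrow> (\<lambda>(t, x). step_process n p \<xi> t x) \<in> borel_measurable (time_space S)"
  unfolding step_process_eq by (rule family_process_measurable[OF step_data_family])

lemma time_space_diff_measurable:
  assumes "(\<lambda>(t, x). f t x) \<in> borel_measurable (time_space T)" "(\<lambda>(t, x). g t x) \<in> borel_measurable (time_space T)"
  shows "(\<lambda>(t, x). f t x - g t x :: 'b::euclidean_space) \<in> borel_measurable (time_space T)"
  using borel_measurable_diff[OF assms] by (simp add: split_beta')

lemma square_integrable_adapted_iff:
  "square_integrable_adapted M F T H \<longleftrightarrow> L2 (time_space T) (\<lambda>(t, x). H t x) \<and> (\<forall>t\<in>{0..T}. H t \<in> borel_measurable (F t))"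
  unfolding square_integrable_adapted_def L2_iff_msq
  using msq_time_space[of H T] by (auto simp: time_space_def)

lemma is_ito_integral_iff:
  "is_ito_integral M F W T H I \<longleftrightarrow>
     square_integrable_adapted M F T H \<and> I \<in> borel_measurable M \<and>
     (\<exists>n p \<xi>. (\<forall>k. step_data M F T (n k) (p k) (\<xi> k)) \<and>
        (\<lambda>k. msq (time_space T) (\<lambda>(t, x). H t x - step_process (n k) (p k) (\<xi> k) t x)) \<longlonglongrightarrow> 0 \<and>
        (\<lambda>k. msq M (\<lambda>x. I x - step_integral W (n k) (p k) (\<xi> k) x)) \<longlonglongrightarrow> 0)"
proof -
  have "msq (time_space T) (\<lambda>(t, x). H t x - step_process n p \<xi> t x) =
     (\<integral>\<^sup>+ x. (\<integral>\<^sup>+ t\<in>{0..T}. ennreal ((norm (H t x - step_process n p \<xi> t x))\<^sup>2) \<partial>lborel) \<partial>M)"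
    if "square_integrable_adapted M F T H" "step_data M F T n p \<xi>" for n p \<xi>
    using that step_process_measurable
    by (intro msq_time_space time_space_diff_measurable)
      (auto simp: square_integrable_adapted_iff L2_def)
  then have "(\<forall>k. step_data M F T (n k) (p k) (\<xi> k)) \<and>
      (\<lambda>k. \<integral>\<^sup>+ x. (\<integral>\<^sup>+ t\<in>{0..T}. ennreal ((norm (H t x - step_process (n k) (p k) (\<xi> k) t x))\<^sup>2) \<partial>lborel) \<partial>M)
        \<longlonglongrightarrow> 0 \<and>
      (\<lambda>k. \<integral>\<^sup>+ x. ennreal ((norm (I x - step_integral W (n k) (p k) (\<xi> k) x))\<^sup>2) \<partial>M) \<longlonglongrightarrow> 0 \<longleftrightarrow>
    (\<forall>k. step_data M F T (n k) (p k) (\<xi> k)) \<and>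
      (\<lambda>k. msq (time_space T) (\<lambda>(t, x). H t x - step_process (n k) (p k) (\<xi> k) t x)) \<longlonglongrightarrow> 0 \<and>
      (\<lambda>k. msq M (\<lambda>x. I x - step_integral W (n k) (p k) (\<xi> k) x)) \<longlonglongrightarrow> 0"
    if "square_integrable_adapted M F T H" for n p \<xi>
    using that unfolding msq_def[of M] by (intro conj_cong refl) simp
  then show ?thesis
    unfolding is_ito_integral_def by (intro conj_cong refl) (simp only:)
qed

lemma ito_integral_approx:
  assumes "is_ito_integral M F W T H I"
  obtains n p \<xi> where "\<And>k. step_family T {..<n k} (p k) (\<lambda>i. p k (Suc i)) (\<xi> k)"
    "(\<lambda>k. msq (time_space T) (\<lambda>(t, x). H t x - family_process {..<n k} (p k) (\<lambda>i. p k (Suc i)) (\<xi> k) t x)) \<longlonglongrightarrow> 0"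
    "(\<lambda>k. msq M (\<lambda>x. family_integral {..<n k :: nat} (p k) (\<lambda>i. p k (Suc i)) (\<xi> k) x - I x)) \<longlonglongrightarrow> 0"
    "L2 M I"
proof -
  obtain n p \<xi> where *: "\<And>k. step_data M F T (n k) (p k) (\<xi> k)"
    "(\<lambda>k. msq (time_space T) (\<lambda>(t, x). H t x - step_process (n k) (p k) (\<xi> k) t x)) \<longlonglongrightarrow> 0"
    "(\<lambda>k. msq M (\<lambda>x. I x - step_integral W (n k) (p k) (\<xi> k) x)) \<longlonglongrightarrow> 0" and I: "I \<in> borel_measurable M"
    using assms unfolding is_ito_integral_iff by blast
  note fam = step_data_family[OF *(1)]
  \<comment> \<open>\<open>is_ito_integral\<close> asks of \<open>I\<close> itself only
    measurability. A single index at finite distance from a square integrable step integral makes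
    \<open>I\<close> square integrable.\<close>
  have "\<forall>\<^sub>F k in sequentially. msq M (\<lambda>x. I x - step_integral W (n k) (p k) (\<xi> k) x) < 1"
    by (rule order_tendstoD(2)[OF *(3)]) simp
  then obtain k where "msq M (\<lambda>x. I x - step_integral W (n k) (p k) (\<xi> k) x) < 1"
    by (auto simp: eventually_sequentially)
  then have k: "msq M (\<lambda>x. I x - family_integral {..<n k} (p k) (\<lambda>i. p k (Suc i)) (\<xi> k) x) < \<infinity>"
    unfolding step_integral_eq by (rule order.strict_trans) simp
  have "L2 M (\<lambda>x. I x - family_integral {..<n k} (p k) (\<lambda>i. p k (Suc i)) (\<xi> k) x)"
    unfolding L2_iff_msq using k I L2_measurable[OF family_integral_L2[OF fam[of k]]] by simp
  from L2_add[OF this family_integral_L2[OF fam[of k]]] have "L2 M I" by simp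
  with fam *(2,3) show thesis
    by (intro that[of n p \<xi>]) (simp_all add: step_process_eq step_integral_eq msq_minus_commute[of M I])
qed

lemma ito_integral_L2: "is_ito_integral M F W T H I \<Longrightarrow> L2 M I"
  by (rule ito_integral_approx)

lemma family_process_L2: "step_family T J a b \<xi> \<Longrightarrow> L2 (time_space T) (\<lambda>(t, x). family_process J a b \<xi> t x)"
  unfolding L2_iff_msq family_isometry
  using family_integral_L2[of T J a b \<xi>] by (simp add: family_process_measurable L2_iff_msq)

text \<open>The isometry of step families passes to the limit, since the norms converge on both
  sides.\<close>

lemma ito_isometry:
  assumes "is_ito_integral M F W T H I"
  shows "(\<integral>x. (norm (I x))\<^sup>2 \<partial>M) = (\<integral>(t, x). (norm (H t x))\<^sup>2 \<partial>time_space T)"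
proof -
  obtain n p \<xi> where *: "\<And>k. step_family T {..<n k} (p k) (\<lambda>i. p k (Suc i)) (\<xi> k)"
    "(\<lambda>k. msq (time_space T) (\<lambda>(t, x). H t x - family_process {..<n k} (p k) (\<lambda>i. p k (Suc i)) (\<xi> k) t x)) \<longlonglongrightarrow> 0"
    "(\<lambda>k. msq M (\<lambda>x. family_integral {..<n k :: nat} (p k) (\<lambda>i. p k (Suc i)) (\<xi> k) x - I x)) \<longlonglongrightarrow> 0"
    "L2 M I"
    using ito_integral_approx[OF assms] by blast
  let ?p = "\<lambda>k (t, x). family_process {..<n k} (p k) (\<lambda>i. p k (Suc i)) (\<xi> k) t x"
  let ?i = "\<lambda>k. family_integral {..<n k} (p k) (\<lambda>i. p k (Suc i)) (\<xi> k)"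
  have H: "L2 (time_space T) (\<lambda>(t, x). H t x)"
    using assms unfolding is_ito_integral_def square_integrable_adapted_iff by simp
  have "(\<lambda>k. msq (time_space T) (\<lambda>z. ?p k z - (case z of (t, x) \<Rightarrow> H t x))) \<longlonglongrightarrow> 0"
    using *(2) by (subst msq_minus_commute) (simp add: split_beta')
  from L2_norm_tendsto[OF H family_process_L2[OF *(1)] this]
  have "(\<lambda>k. \<integral>z. (norm (?p k z))\<^sup>2 \<partial>time_space T) \<longlonglongrightarrow> (\<integral>(t, x). (norm (H t x))\<^sup>2 \<partial>time_space T)"
    by (simp add: split_beta')
  moreover have "(\<integral>z. (norm (?p k z))\<^sup>2 \<partial>time_space T) = (\<integral>x. (norm (?i k x))\<^sup>2 \<partial>M)" for k
    using family_isometry[OF *(1)[of k]] msq_eq[OF family_process_L2[OF *(1)[of k]]]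
      msq_eq[OF family_integral_L2[OF *(1)[of k]]] by simp
  moreover have "(\<lambda>k. \<integral>x. (norm (?i k x))\<^sup>2 \<partial>M) \<longlonglongrightarrow> (\<integral>x. (norm (I x))\<^sup>2 \<partial>M)"
    by (rule L2_norm_tendsto[OF *(4) family_integral_L2[OF *(1)] *(3)])
  ultimately show ?thesis
    by (simp add: LIMSEQ_unique)
qed

text \<open>\<open>I\<close> and \<open>I'\<close> come with unrelated approximations. Truncating
  that of \<open>I\<close> at \<open>r\<close> gives a second approximation of \<open>H\<close> on
  \<open>[0,r]\<close>, and the isometry shows that both yield \<open>I'\<close> in the limit. The
  martingale property of step families then passes to the limit.\<close>

lemma ito_martingale:
  fixes Y :: "'a \<Rightarrow> 'b::euclidean_space"
  assumes IT: "is_ito_integral M F W T H I" and Ir: "is_ito_integral M F W r H I'" and r: "0 \<le> r" "r \<le> T"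
    and Y: "Y \<in> borel_measurable (F r)" "L2 M Y"
  shows "(\<integral>x. Y x \<bullet> I x \<partial>M) = (\<integral>x. Y x \<bullet> I' x \<partial>M)"
proof -
  obtain n p \<xi> where *: "\<And>k. step_family T {..<n k} (p k) (\<lambda>i. p k (Suc i)) (\<xi> k)"
    "(\<lambda>k. msq (time_space T) (\<lambda>(t, x). H t x - family_process {..<n k} (p k) (\<lambda>i. p k (Suc i)) (\<xi> k) t x)) \<longlonglongrightarrow> 0"
    "(\<lambda>k. msq M (\<lambda>x. family_integral {..<n k :: nat} (p k) (\<lambda>i. p k (Suc i)) (\<xi> k) x - I x)) \<longlonglongrightarrow> 0"
    "L2 M I"
    using ito_integral_approx[OF IT] by blast
  obtain n' p' \<xi>' where **: "\<And>k. step_family r {..<n' k} (p' k) (\<lambda>i. p' k (Suc i)) (\<xi>' k)"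
    "(\<lambda>k. msq (time_space r) (\<lambda>(t, x). H t x - family_process {..<n' k} (p' k) (\<lambda>i. p' k (Suc i)) (\<xi>' k) t x)) \<longlonglongrightarrow> 0"
    "(\<lambda>k. msq M (\<lambda>x. family_integral {..<n' k :: nat} (p' k) (\<lambda>i. p' k (Suc i)) (\<xi>' k) x - I' x)) \<longlonglongrightarrow> 0"
    "L2 M I'"
    using ito_integral_approx[OF Ir] by blast
  let ?P = "\<lambda>k. family_process {..<n k} (p k) (\<lambda>i. p k (Suc i)) (\<xi> k)"
  let ?I = "\<lambda>k. family_integral {..<n k} (p k) (\<lambda>i. p k (Suc i)) (\<xi> k)"
  let ?P' = "\<lambda>k. family_process {..<n' k} (p' k) (\<lambda>i. p' k (Suc i)) (\<xi>' k)"
  let ?I' = "\<lambda>k. family_integral {..<n' k} (p' k) (\<lambda>i. p' k (Suc i)) (\<xi>' k)"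
  let ?Pr = "\<lambda>k. family_process {j\<in>{..<n k}. p k j < r} (p k) (\<lambda>i. min r (p k (Suc i))) (\<xi> k)"
  let ?Ir = "\<lambda>k. family_integral {j\<in>{..<n k}. p k j < r} (p k) (\<lambda>i. min r (p k (Suc i))) (\<xi> k)"
  note famr = family_truncate[OF *(1) r(1)]
  have HT: "(\<lambda>(t, x). H t x) \<in> borel_measurable (time_space T)"
    using IT unfolding is_ito_integral_def square_integrable_adapted_iff by (simp add: L2_measurable)
  have Hr: "(\<lambda>(t, x). H t x) \<in> borel_measurable (time_space r)"
    using Ir unfolding is_ito_integral_def square_integrable_adapted_iff by (simp add: L2_measurable)
  have Pm: "(\<lambda>(t, x). ?P k t x) \<in> borel_measurable (time_space T)"
    "(\<lambda>(t, x). ?Pr k t x) \<in> borel_measurable (time_space r)"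
    "(\<lambda>(t, x). ?P' k t x) \<in> borel_measurable (time_space r)" for k
    using family_process_measurable[OF *(1)] family_process_measurable[OF famr]
      family_process_measurable[OF **(1)] by auto
  \<comment> \<open>Up to time \<open>r\<close> truncation does not change the process, so the error
    over \<open>[0,r]\<close> is part of the error over \<open>[0,T]\<close>.\<close>
  have "msq (time_space r) (\<lambda>(t, x). H t x - ?Pr k t x) \<le> msq (time_space T) (\<lambda>(t, x). H t x - ?P k t x)" for k
  proof -
    have "ennreal ((norm (H t x - ?Pr k t x))\<^sup>2) * indicator {0..r} t
      \<le> ennreal ((norm (H t x - ?P k t x))\<^sup>2) * indicator {0..T} t" for t x
    proof (cases "t \<in> {0..r}")
      case True
      then have "?Pr k t x = ?P k t x" by (intro family_process_truncate) auto
      then show ?thesis using True r by (simp only:) simp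
    qed simp
    then show ?thesis
      using msq_time_space[OF time_space_diff_measurable[OF HT Pm(1)[of k]]]
        msq_time_space[OF time_space_diff_measurable[OF Hr Pm(2)[of k]]]
      by (auto intro!: nn_integral_mono)
  qed
  then have 1: "(\<lambda>k. msq (time_space r) (\<lambda>(t, x). H t x - ?Pr k t x)) \<longlonglongrightarrow> 0"
    by (intro ennreal_tendsto_0_le[OF *(2), where c=1]) auto
  have "(\<lambda>k. msq (time_space r) (\<lambda>z. (case z of (t, x) \<Rightarrow> ?Pr k t x) - (case z of (t, x) \<Rightarrow> ?P' k t x))) \<longlonglongrightarrow> 0"
  proof (rule msq_tendsto_0_triangle[OF Pm(2) Hr Pm(3)])
    show "(\<lambda>k. msq (time_space r) (\<lambda>z. (case z of (t, x) \<Rightarrow> H t x) - (case z of (t, x) \<Rightarrow> ?P' k t x))) \<longlonglongrightarrow> 0"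
      using **(2) by (simp add: split_beta')
    show "(\<lambda>k. msq (time_space r) (\<lambda>z. (case z of (t, x) \<Rightarrow> ?Pr k t x) - (case z of (t, x) \<Rightarrow> H t x))) \<longlonglongrightarrow> 0"
      using 1 by (subst msq_minus_commute) (simp add: split_beta')
  qed
  \<comment> \<open>Two step processes that approach each other have integrals that do so as
    well.\<close>
  then have "(\<lambda>k. msq M (\<lambda>x. ?Ir k x - ?I' k x)) \<longlonglongrightarrow> 0"
    using family_diff[OF famr **(1)] by (simp add: split_beta')
  then have "(\<lambda>k. msq M (\<lambda>x. ?Ir k x - I' x)) \<longlonglongrightarrow> 0"
    by (rule msq_tendsto_0_triangle[OF L2_measurable[OF family_integral_L2[OF famr]]
          L2_measurable[OF family_integral_L2[OF **(1)]] L2_measurable[OF **(4)] _ **(3)])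
  then have "(\<lambda>k. \<integral>x. Y x \<bullet> ?Ir k x \<partial>M) \<longlonglongrightarrow> (\<integral>x. Y x \<bullet> I' x \<partial>M)"
    by (intro L2_inner_tendsto[OF Y(2) **(4) family_integral_L2[OF famr]])
  moreover have "(\<lambda>k. \<integral>x. Y x \<bullet> ?I k x \<partial>M) \<longlonglongrightarrow> (\<integral>x. Y x \<bullet> I x \<partial>M)"
    by (rule L2_inner_tendsto[OF Y(2) *(4) family_integral_L2[OF *(1)] *(3)])
  ultimately show ?thesis
    using family_integral_martingale[OF *(1) r(1) Y] by (simp add: LIMSEQ_unique)
qed

section \<open>Images of Ito integrals under linear maps\<close>

lemma square_integrable_adapted_bounded_linear:
  assumes f: "bounded_linear f" and H: "square_integrable_adapted M F T H"
  shows "square_integrable_adapted M F T (\<lambda>t x. f (H t x))"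
  using H L2_bounded_linear[OF f, of "time_space T" "\<lambda>(t, x). H t x"]
    measurable_compose[OF _ borel_measurable_continuous_onI[OF linear_continuous_on[OF f, of UNIV]]]
  unfolding square_integrable_adapted_iff by (auto simp: split_beta')

text \<open>Applying \<open>f\<close> to the coefficients of the approximating step processes
  commutes with both sums by linearity, and the errors grow at most by a constant factor.\<close>

lemma is_ito_integral_bounded_linear:
  fixes f :: "'b::euclidean_space \<Rightarrow> 'c::euclidean_space"
  assumes f: "bounded_linear f" and I: "is_ito_integral M F W T H I"
  shows "is_ito_integral M F W T (\<lambda>t x. f (H t x)) (\<lambda>x. f (I x))"
proof -
  obtain n p \<xi> where *: "\<And>k. step_data M F T (n k) (p k) (\<xi> k)"
    "(\<lambda>k. msq (time_space T) (\<lambda>(t, x). H t x - step_process (n k) (p k) (\<xi> k) t x)) \<longlonglongrightarrow> 0"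
    "(\<lambda>k. msq M (\<lambda>x. I x - step_integral W (n k) (p k) (\<xi> k) x)) \<longlonglongrightarrow> 0" and Im: "I \<in> borel_measurable M"
    and H: "square_integrable_adapted M F T H"
    using I unfolding is_ito_integral_iff by blast
  interpret f: bounded_linear f by fact
  note fm = borel_measurable_continuous_onI[OF linear_continuous_on[OF f, of UNIV]]
  obtain K where K: "0 < K" "\<And>(N :: (real \<times> 'a) measure) g. g \<in> borel_measurable N \<Longrightarrow> msq N (\<lambda>x. f (g x)) \<le> ennreal K * msq N g"
    using msq_bounded_linear_le[OF f] by metis
  \<comment> \<open>The same bound once more, because each instance fixes the type of the underlying
    space.\<close>
  obtain K' where K': "\<And>(N :: 'a measure) g. g \<in> borel_measurable N \<Longrightarrow> msq N (\<lambda>x. f (g x)) \<le> ennreal K' * msq N g"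
    using msq_bounded_linear_le[OF f] by metis
  have 1: "step_data M F T (n k) (p k) (\<lambda>i x. f (\<xi> k i x))" for k
  proof -
    obtain L where L: "\<And>x. norm (f x) \<le> norm x * L" "0 \<le> L" using f.nonneg_bounded by auto
    have m: "(\<lambda>x. f (\<xi> k i x)) \<in> borel_measurable (F (p k i))" if "i < n k" for i
      using *(1)[of k] that by (intro measurable_compose[OF _ fm]) (simp add: step_data_def)
    have "\<exists>C. \<forall>x\<in>space M. norm (f (\<xi> k i x)) \<le> C" if "i < n k" for i
    proof -
      obtain C where "\<forall>x\<in>space M. norm (\<xi> k i x) \<le> C"
        using *(1)[of k] \<open>i < n k\<close> by (auto simp: step_data_def)
      then show ?thesis
        using L by (intro exI[of _ "C * L"] ballI order_trans[OF L(1)] mult_right_mono) auto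
    qed
    then show ?thesis
      using *(1)[of k] m by (simp add: step_data_def)
  qed
  have p: "f (H t x) - step_process (n k) (p k) (\<lambda>i x. f (\<xi> k i x)) t x = f (H t x - step_process (n k) (p k) (\<xi> k) t x)" for k t x
    by (simp only: step_process_def f.diff f.sum f.scaleR)
  have i: "f (I x) - step_integral W (n k) (p k) (\<lambda>i x. f (\<xi> k i x)) x = f (I x - step_integral W (n k) (p k) (\<xi> k) x)" for k x
    by (simp add: step_integral_def f.diff f.sum f.scaleR)
  have pm: "(\<lambda>(t, x). H t x - step_process (n k) (p k) (\<xi> k) t x) \<in> borel_measurable (time_space T)" for k
    using H by (intro time_space_diff_measurable step_process_measurable[OF *(1)])
      (simp add: square_integrable_adapted_iff L2_measurable)
  have im: "(\<lambda>x. I x - step_integral W (n k) (p k) (\<xi> k) x) \<in> borel_measurable M" for k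
    unfolding step_integral_eq by (intro borel_measurable_diff Im L2_measurable[OF family_integral_L2[OF step_data_family[OF *(1)]]])
  have "(\<lambda>k. msq (time_space T) (\<lambda>(t, x). f (H t x) - step_process (n k) (p k) (\<lambda>i x. f (\<xi> k i x)) t x)) \<longlonglongrightarrow> 0"
    unfolding p
  proof (rule ennreal_tendsto_0_le[OF *(2)])
    show "msq (time_space T) (\<lambda>(t, x). f (H t x - step_process (n k) (p k) (\<xi> k) t x))
      \<le> ennreal K * msq (time_space T) (\<lambda>(t, x). H t x - step_process (n k) (p k) (\<xi> k) t x)" for k
      using K(2)[OF pm[of k]] by (simp add: split_beta')
  qed simp
  moreover have "(\<lambda>k. msq M (\<lambda>x. f (I x) - step_integral W (n k) (p k) (\<lambda>i x. f (\<xi> k i x)) x)) \<longlonglongrightarrow> 0"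
    unfolding i by (rule ennreal_tendsto_0_le[OF *(3) K'[OF im]]) simp
  ultimately show ?thesis
    unfolding is_ito_integral_iff
    by (intro conjI exI[of _ n] exI[of _ p] exI[of _ "\<lambda>k i x. f (\<xi> k i x)"] allI
        square_integrable_adapted_bounded_linear[OF f H] 1 measurable_compose[OF Im fm])
qed

end

section \<open>Second moments of Ito processes\<close>

text \<open>The decomposition is required separately for each time: \<open>I t\<close> is some
  version of the integral over \<open>[0,t]\<close>, and no regularity of \<open>I\<close> in
  \<open>t\<close> is asked for.\<close>

locale ito_process = wiener_process M F W
  for M :: "'a measure" and F :: "real \<Rightarrow> 'a measure" and W :: "real \<Rightarrow> 'a \<Rightarrow> real" +
  fixes U a g :: "real \<Rightarrow> 'a \<Rightarrow> 'b::euclidean_space" and I :: "real \<Rightarrow> 'a \<Rightarrow> 'b"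
  assumes U: "0 \<le> t \<Longrightarrow> square_integrable_adapted M F t U"
    and drift: "0 \<le> t \<Longrightarrow> square_integrable_adapted M F t a"
    and drift_continuous: "AE x in M. continuous_on {0..} (\<lambda>t. a t x)"
    and ito: "0 \<le> t \<Longrightarrow> is_ito_integral M F W t g (I t)"
    and decomposition: "0 \<le> t \<Longrightarrow> AE x in M. U t x = U 0 x + (LINT r:{0..t}|lborel. a r x) + I t x"
begin

definition drift_integral :: "real \<Rightarrow> 'a \<Rightarrow> 'b" where
  "drift_integral t x = (LINT r:{0..t}|lborel. a r x)"

section \<open>Square integrability of the components\<close>

lemma U_L2_time: "0 \<le> t \<Longrightarrow> L2 (time_space t) (\<lambda>(r, x). U r x)"
  using U by (auto simp: square_integrable_adapted_iff)

lemma drift_L2_time: "0 \<le> t \<Longrightarrow> L2 (time_space t) (\<lambda>(r, x). a r x)"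
  using drift by (auto simp: square_integrable_adapted_iff)

lemma noise_L2_time: "0 \<le> t \<Longrightarrow> L2 (time_space t) (\<lambda>(r, x). g r x)"
  using ito by (auto simp: square_integrable_adapted_iff is_ito_integral_def)

lemma U_adapted: "0 \<le> t \<Longrightarrow> U t \<in> borel_measurable (F t)"
  using U[of t] by (auto simp: square_integrable_adapted_iff)

lemma drift_adapted: "0 \<le> t \<Longrightarrow> a t \<in> borel_measurable (F t)"
  using drift[of t] by (auto simp: square_integrable_adapted_iff)

lemma drift_integral_measurable: "0 \<le> t \<Longrightarrow> drift_integral t \<in> borel_measurable M"
proof -
  assume "0 \<le> t"
  interpret P: pair_sigma_finite "leb t" M by (rule pair_sigma_finite_time)
  note [measurable] = L2_measurable[OF drift_L2_time[OF \<open>0 \<le> t\<close>], unfolded time_space_def]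
  have "(\<lambda>x. \<integral>r. a r x \<partial>leb t) \<in> borel_measurable M"
    by (rule P.M1.borel_measurable_lebesgue_integral) measurable
  then show ?thesis by (simp add: drift_integral_def[abs_def] LINT_Icc_restrict)
qed

text \<open>Cauchy-Schwarz in time along each path, then Tonelli. The bound is uniform in
  \<open>t\<close> up to \<open>T\<close>, as the estimate on the time space requires.\<close>

lemma msq_drift_integral_le:
  assumes "0 \<le> t" "t \<le> T"
  shows "msq M (drift_integral t) \<le> ennreal T * msq (time_space T) (\<lambda>(r, x). a r x)"
proof -
  interpret P: pair_sigma_finite "leb t" M by (rule pair_sigma_finite_time)
  note [measurable] = L2_measurable[OF drift_L2_time[OF \<open>0 \<le> t\<close>], unfolded time_space_def]
  have "AE x in M. ennreal ((norm (drift_integral t x))\<^sup>2) \<le> ennreal t * (\<integral>\<^sup>+ r. ennreal ((norm (a r x))\<^sup>2) \<partial>leb t)"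
    using AE_L2_path[OF drift_L2_time[OF assms(1)]]
  proof eventually_elim
    case (elim x)
    have "(norm (drift_integral t x))\<^sup>2 \<le> t * (\<integral>r. (norm (a r x))\<^sup>2 \<partial>leb t)"
      using norm_integral_power2_le[OF finite_measure_restrict_lborel elim] assms
      by (simp add: drift_integral_def LINT_Icc_restrict measure_restrict_space space_restrict_space)
    then have "ennreal ((norm (drift_integral t x))\<^sup>2) \<le> ennreal t * ennreal (\<integral>r. (norm (a r x))\<^sup>2 \<partial>leb t)"
      using assms by (simp flip: ennreal_mult)
    then show ?case
      using L2_integrable[OF elim] by (subst nn_integral_eq_integral) auto
  qed
  then have "msq M (drift_integral t) \<le> (\<integral>\<^sup>+ x. ennreal t * (\<integral>\<^sup>+ r. ennreal ((norm (a r x))\<^sup>2) \<partial>leb t) \<partial>M)"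
    unfolding msq_def by (rule nn_integral_mono_AE)
  also have "\<dots> = ennreal t * (\<integral>\<^sup>+ x. (\<integral>\<^sup>+ r\<in>{0..t}. ennreal ((norm (a r x))\<^sup>2) \<partial>lborel) \<partial>M)"
    by (subst nn_integral_cmult) (measurable, simp add: nn_integral_restrict_space)
  also have "\<dots> \<le> ennreal T * (\<integral>\<^sup>+ x. (\<integral>\<^sup>+ r\<in>{0..T}. ennreal ((norm (a r x))\<^sup>2) \<partial>lborel) \<partial>M)"
    using assms by (intro mult_mono nn_integral_mono ennreal_leI mult_left_mono) (auto split: split_indicator)
  also have "\<dots> = ennreal T * msq (time_space T) (\<lambda>(r, x). a r x)"
    using assms by (subst msq_time_space) (auto intro!: L2_measurable[OF drift_L2_time])
  finally show ?thesis .
qed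

lemma drift_integral_L2: "0 \<le> t \<Longrightarrow> L2 M (drift_integral t)"
  using msq_drift_integral_le[of t t] drift_L2_time[of t] drift_integral_measurable[of t]
  by (auto simp: L2_iff_msq ennreal_mult_less_top intro: le_less_trans)

lemma I_L2: "0 \<le> t \<Longrightarrow> L2 M (I t)"
  by (rule ito_integral_L2[OF ito])

lemma U_measurable: "0 \<le> t \<Longrightarrow> U t \<in> borel_measurable M"
  by (rule measurable_F_imp_M[OF U_adapted])

text \<open>Square integrability is given only over time and space, hence for almost every time
  slice. From one such time \<open>r\<close> the decomposition is solved for
  \<open>U 0\<close>.\<close>

lemma U0_L2: "L2 M (U 0)"
proof -
  have "AE r in leb 1. L2 M (U r)"
    by (rule AE_L2_slice[OF U_L2_time]) simp
  \<comment> \<open>The interval \<open>[0,1]\<close> is not a null set, so a property of almost all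
    its times holds at one of them.\<close>
  have "\<exists>r. 0 \<le> r \<and> L2 M (U r)"
  proof (rule ccontr)
    assume "\<not> ?thesis"
    with \<open>AE r in leb 1. L2 M (U r)\<close> AE_space[of "leb 1"] have "AE r in leb 1. \<not> True"
      by (auto simp: space_restrict_space elim: eventually_elim2)
    then have "emeasure (leb 1) {x \<in> space (leb 1). True} = 0" by (rule emeasure_eq_0_AE)
    moreover have "{x \<in> space (leb 1). True} = {0..1}" by (auto simp: space_restrict_space)
    ultimately show False by (simp add: emeasure_restrict_space)
  qed
  then obtain r where r: "0 \<le> r" "L2 M (U r)" by blast
  have "AE x in M. U 0 x = U r x - drift_integral r x - I r x"
    using decomposition[OF r(1)] by eventually_elim (simp add: drift_integral_def)
  from L2_cong_AE[OF this U_measurable] show ?thesis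
    using r by (simp add: L2_diff drift_integral_L2 I_L2)
qed

lemma U_L2: "0 \<le> t \<Longrightarrow> L2 M (U t)"
  using decomposition[of t] unfolding drift_integral_def[symmetric]
  by (rule L2_cong_AE) (assumption | intro U_measurable L2_add U0_L2 drift_integral_L2 I_L2)+

text \<open>\<open>U\<close> without its Ito integral. Wherever the drift path is continuous this
  path is differentiable in time, so ordinary calculus applies to it.\<close>

definition finite_variation :: "real \<Rightarrow> 'a \<Rightarrow> 'b" where
  "finite_variation t x = U 0 x + drift_integral t x"

lemma finite_variation_L2: "0 \<le> t \<Longrightarrow> L2 M (finite_variation t)"
  unfolding finite_variation_def[abs_def] by (intro L2_add U0_L2 drift_integral_L2)

lemma finite_variation_L2_time:
  assumes "0 \<le> T"
  shows "L2 (time_space T) (\<lambda>(r, x). finite_variation r x)"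
  unfolding L2_iff_msq
proof
  interpret P: pair_sigma_finite "leb T" M by (rule pair_sigma_finite_time)
  have [measurable]: "U 0 \<in> borel_measurable M" by (rule U_measurable) simp
  note [measurable] = L2_measurable[OF drift_L2_time[OF assms], unfolded time_space_def]
  \<comment> \<open>Moving the variable upper limit into an indicator leaves an integral over a
    fixed space, which is measurable in its parameters.\<close>
  have "(\<lambda>z. \<integral>u. indicator {0..fst z} u *\<^sub>R a u (snd z) \<partial>leb T) \<in> borel_measurable (time_space T)"
  proof (rule P.M1.borel_measurable_lebesgue_integral)
    let ?Q = "time_space T \<Otimes>\<^sub>M leb T"
    have id: "(\<lambda>u. u) \<in> borel_measurable (leb T)"
      by (intro measurable_restrict_space1) simp
    have [measurable]: "(\<lambda>z. fst (fst z)) \<in> borel_measurable ?Q"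
      unfolding time_space_def by (rule measurable_compose[OF measurable_compose[OF measurable_fst measurable_fst] id])
    have [measurable]: "snd \<in> borel_measurable ?Q"
      by (rule measurable_compose[OF measurable_snd id])
    have "(\<lambda>z. (snd z, snd (fst z))) \<in> measurable ?Q (leb T \<Otimes>\<^sub>M M)"
      unfolding time_space_def by measurable
    from measurable_compose[OF this L2_measurable[OF drift_L2_time[OF assms], unfolded time_space_def]]
    have [measurable]: "(\<lambda>z. a (snd z) (snd (fst z))) \<in> borel_measurable ?Q" by simp
    have "(\<lambda>(z, u). indicator {0..fst z} u *\<^sub>R a u (snd z))
        = (\<lambda>z. (if 0 \<le> snd z \<and> snd z \<le> fst (fst z) then 1 else 0) *\<^sub>R a (snd z) (snd (fst z)))"
      by (auto simp: indicator_def)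
    also have "\<dots> \<in> borel_measurable ?Q" by measurable
    finally show "(\<lambda>(z, u). indicator {0..fst z} u *\<^sub>R a u (snd z)) \<in> borel_measurable ?Q" .
  qed
  moreover have "drift_integral r x = (\<integral>u. indicator {0..r} u *\<^sub>R a u x \<partial>leb T)" if "r \<in> {0..T}" for r x
    unfolding drift_integral_def set_lebesgue_integral_def using that
    by (subst integral_restrict_space) (auto intro!: Bochner_Integration.integral_cong split: split_indicator)
  ultimately have "(\<lambda>z. drift_integral (fst z) (snd z)) \<in> borel_measurable (time_space T)"
    by (subst measurable_cong) (auto simp: time_space_def space_pair_measure space_restrict_space)
  then show Xm: "(\<lambda>(r, x). finite_variation r x) \<in> borel_measurable (time_space T)"
    unfolding finite_variation_def time_space_def split_beta' by measurable
  have "msq (time_space T) (\<lambda>(r, x). finite_variation r x) = (\<integral>\<^sup>+ r. msq M (finite_variation r) \<partial>leb T)"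
    using Xm unfolding msq_def time_space_def
    by (subst nn_integral_fst[symmetric]) (auto simp: split_beta')
  also have "\<dots> \<le> (\<integral>\<^sup>+ r. 2 * msq M (U 0) + 2 * (ennreal T * msq (time_space T) (\<lambda>(r, x). a r x)) \<partial>leb T)"
  proof (rule nn_integral_mono)
    fix r assume "r \<in> space (leb T)"
    then have r: "0 \<le> r" "r \<le> T" by (auto simp: space_restrict_space)
    show "msq M (finite_variation r) \<le> 2 * msq M (U 0) + 2 * (ennreal T * msq (time_space T) (\<lambda>(r, x). a r x))"
      unfolding finite_variation_def[abs_def]
      by (rule order_trans[OF msq_add_le add_left_mono[OF mult_left_mono[OF msq_drift_integral_le[OF r]]]])
        (use r in \<open>auto intro: U_measurable drift_integral_measurable\<close>)
  qed
  also have "\<dots> < \<infinity>"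
    using U0_L2 drift_L2_time[OF assms] assms
    by (auto simp: L2_iff_msq emeasure_restrict_space space_restrict_space ennreal_mult_less_top)
  finally show "msq (time_space T) (\<lambda>(r, x). finite_variation r x) < \<infinity>" .
qed

text \<open>The product rule along one path: the derivative of the squared norm is twice the inner
  product with the drift.\<close>

lemma finite_variation_FTC:
  assumes c: "continuous_on {0..} (\<lambda>t. a t x)" and T: "0 \<le> T"
  shows "(norm (finite_variation T x))\<^sup>2 = (norm (U 0 x))\<^sup>2 + 2 * (\<integral>r. a r x \<bullet> finite_variation r x \<partial>leb T)"
proof -
  have ac: "continuous_on {0..t} (\<lambda>t. a t x)" for t
    by (rule continuous_on_subset[OF c]) auto
  have D_eq: "drift_integral t x = integral {0..t} (\<lambda>r. a r x)" if "0 \<le> t" for t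
    unfolding drift_integral_def by (rule set_borel_integral_eq_integral) (rule borel_integrable_atLeastAtMost'[OF ac])
  have "((\<lambda>t. integral {0..t} (\<lambda>r. a r x)) has_vector_derivative a t x) (at t within {0..T})" if "t \<in> {0..T}" for t
    by (rule integral_has_vector_derivative[OF ac that])
  then have Dd: "((\<lambda>t. drift_integral t x) has_vector_derivative a t x) (at t within {0..T})" if "t \<in> {0..T}" for t
    using D_eq that by (subst has_vector_derivative_cong_ev[where g="\<lambda>t. integral {0..t} (\<lambda>r. a r x)"]) (auto simp: eventually_at_filter)
  then have Xd: "((\<lambda>t. finite_variation t x) has_vector_derivative a t x) (at t within {0..T})" if "t \<in> {0..T}" for t
    unfolding finite_variation_def using that by (auto intro!: derivative_eq_intros)
  then have Xc: "continuous_on {0..T} (\<lambda>t. finite_variation t x)"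
    unfolding continuous_on_eq_continuous_within using has_vector_derivative_continuous by blast
  have "((\<lambda>t. finite_variation t x \<bullet> finite_variation t x) has_vector_derivative 2 * (a t x \<bullet> finite_variation t x)) (at t within {0..T})" if "t \<in> {0..T}" for t
    using Xd[OF that] unfolding has_vector_derivative_def
    by (auto intro!: derivative_eq_intros simp: inner_commute)
  then have "(\<integral>t. indicator {0..T} t *\<^sub>R (2 * (a t x \<bullet> finite_variation t x)) \<partial>lborel) = finite_variation T x \<bullet> finite_variation T x - finite_variation 0 x \<bullet> finite_variation 0 x"
    using T ac[of T] Xc by (intro integral_FTC_atLeastAtMost) (auto intro!: continuous_intros)
  moreover have "drift_integral 0 x = 0"
    by (simp add: D_eq)
  ultimately show ?thesis
    by (simp add: finite_variation_def[of 0] power2_norm_eq_inner integral_restrict_space mult.left_commute)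
qed

lemma finite_variation_second_moment:
  assumes T: "0 \<le> T"
  shows "(\<integral>x. (norm (finite_variation T x))\<^sup>2 \<partial>M) = (\<integral>x. (norm (U 0 x))\<^sup>2 \<partial>M) + 2 * (\<integral>r. (\<integral>x. a r x \<bullet> finite_variation r x \<partial>M) \<partial>leb T)"
proof -
  interpret P: pair_sigma_finite "leb T" M by (rule pair_sigma_finite_time)
  note aX = time_inner_integrable[OF drift_L2_time[OF T] finite_variation_L2_time[OF T]]
  note i = L2_integrable[OF U0_L2] P.integrable_snd[OF aX]
  have "AE x in M. (norm (finite_variation T x))\<^sup>2 = (norm (U 0 x))\<^sup>2 + 2 * (\<integral>r. a r x \<bullet> finite_variation r x \<partial>leb T)"
    using drift_continuous by eventually_elim (rule finite_variation_FTC[OF _ T])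
  then have "(\<integral>x. (norm (finite_variation T x))\<^sup>2 \<partial>M) = (\<integral>x. (norm (U 0 x))\<^sup>2 + 2 * (\<integral>r. a r x \<bullet> finite_variation r x \<partial>leb T) \<partial>M)"
    using borel_measurable_integrable[OF L2_integrable[OF finite_variation_L2[OF T]]] i[THEN borel_measurable_integrable]
    by (intro integral_cong_AE) auto
  also have "\<dots> = (\<integral>x. (norm (U 0 x))\<^sup>2 \<partial>M) + 2 * (\<integral>r. (\<integral>x. a r x \<bullet> finite_variation r x \<partial>M) \<partial>leb T)"
    using i P.integral_snd[OF aX] P.integral_fst[OF aX] by simp
  finally show ?thesis .
qed

text \<open>The martingale property at \<open>r = 0\<close> replaces \<open>I T\<close> by
  \<open>I 0\<close>, which vanishes almost surely by the decomposition at time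
  \<open>0\<close>.\<close>

lemma I_orthogonal_U0:
  assumes T: "0 \<le> T"
  shows "(\<integral>x. U 0 x \<bullet> I T x \<partial>M) = 0"
proof -
  have D0: "drift_integral 0 x = 0" for x
    unfolding drift_integral_def set_lebesgue_integral_def
    by (rule integral_eq_zero_AE) (use AE_lborel_singleton[of "0::real"] in \<open>eventually_elim, auto\<close>)
  have "AE x in M. U 0 x \<bullet> I 0 x = 0"
    using decomposition[OF order_refl] unfolding drift_integral_def[symmetric] D0 by eventually_elim simp
  then have "(\<integral>x. U 0 x \<bullet> I 0 x \<partial>M) = 0" by (rule integral_eq_zero_AE)
  then show ?thesis
    using ito_martingale[OF ito[OF T] ito[OF order_refl] order_refl T U_adapted[OF order_refl] U0_L2] by simp
qed

text \<open>The part from \<open>U 0\<close> is orthogonal to \<open>I T\<close>; Fubini treats the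
  drift part, with \<open>I T\<close> kept at the final time under the integral.\<close>

lemma finite_variation_I_moment:
  assumes T: "0 \<le> T"
  shows "(\<integral>x. finite_variation T x \<bullet> I T x \<partial>M) = (\<integral>r. (\<integral>x. a r x \<bullet> I T x \<partial>M) \<partial>leb T)"
proof -
  interpret P: pair_sigma_finite "leb T" M by (rule pair_sigma_finite_time)
  note aI = time_inner_integrable[OF drift_L2_time[OF T] L2_const_time[OF I_L2[OF T]]]
  note DI = L2_inner[OF drift_integral_L2[OF T] I_L2[OF T]]
  have "(\<integral>x. finite_variation T x \<bullet> I T x \<partial>M) = (\<integral>x. drift_integral T x \<bullet> I T x \<partial>M)"
    using L2_inner[OF U0_L2 I_L2[OF T]] DI I_orthogonal_U0[OF T] by (simp add: finite_variation_def inner_add_left)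
  also have "AE x in M. drift_integral T x \<bullet> I T x = (\<integral>r. a r x \<bullet> I T x \<partial>leb T)"
    using AE_L2_path[OF drift_L2_time[OF T]]
  proof eventually_elim
    case (elim x)
    from L2_integrable_norm[OF finite_measure_restrict_lborel this] show ?case
      by (simp add: drift_integral_def LINT_Icc_restrict)
  qed
  then have "(\<integral>x. drift_integral T x \<bullet> I T x \<partial>M) = (\<integral>x. (\<integral>r. a r x \<bullet> I T x \<partial>leb T) \<partial>M)"
    using borel_measurable_integrable[OF DI] borel_measurable_integrable[OF P.integrable_snd[OF aI]]
    by (intro integral_cong_AE) auto
  also have "\<dots> = (\<integral>r. (\<integral>x. a r x \<bullet> I T x \<partial>M) \<partial>leb T)"
    using P.integral_snd[OF aI] P.integral_fst[OF aI] by simp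
  finally show ?thesis .
qed

text \<open>The expected value of the generator applied to the squared norm.\<close>

definition moment_rate :: "real \<Rightarrow> real" where
  "moment_rate r = 2 * (\<integral>x. a r x \<bullet> U r x \<partial>M) + (\<integral>x. (norm (g r x))\<^sup>2 \<partial>M)"

lemma moment_rate_integrable:
  assumes T: "0 \<le> T"
  shows "integrable (leb T) moment_rate"
proof -
  interpret P: pair_sigma_finite "leb T" M by (rule pair_sigma_finite_time)
  have "integrable (leb T \<Otimes>\<^sub>M M) (\<lambda>(r, x). (norm (g r x))\<^sup>2)"
    using L2_integrable[OF noise_L2_time[OF T]] by (simp add: time_space_def split_beta')
  from P.integrable_fst[OF this] P.integrable_fst[OF time_inner_integrable[OF drift_L2_time[OF T] U_L2_time[OF T]]]
  show ?thesis unfolding moment_rate_def[abs_def] by simp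
qed

text \<open>Expand the squared norm of \<open>finite_variation T x + I T x\<close>. The isometry
  gives the noise term; in the mixed term \<open>I T\<close> may be replaced by \<open>I r\<close>
  under the time integral, and \<open>finite_variation r x + I r x\<close> is again
  \<open>U r x\<close>.\<close>

lemma second_moment:
  assumes T: "0 \<le> T"
  shows "(\<integral>x. (norm (U T x))\<^sup>2 \<partial>M) = (\<integral>x. (norm (U 0 x))\<^sup>2 \<partial>M) + (\<integral>r. moment_rate r \<partial>leb T)"
proof -
  interpret P: pair_sigma_finite "leb T" M by (rule pair_sigma_finite_time)
  have gg: "integrable (leb T \<Otimes>\<^sub>M M) (\<lambda>(r, x). (norm (g r x))\<^sup>2)"
    using L2_integrable[OF noise_L2_time[OF T]] by (simp add: time_space_def split_beta')
  note i = P.integrable_fst[OF time_inner_integrable[OF drift_L2_time[OF T] finite_variation_L2_time[OF T]]]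
    P.integrable_fst[OF time_inner_integrable[OF drift_L2_time[OF T] L2_const_time[OF I_L2[OF T]]]]
    P.integrable_fst[OF gg]
  have "AE x in M. (norm (U T x))\<^sup>2 = (norm (finite_variation T x))\<^sup>2 + 2 * (finite_variation T x \<bullet> I T x) + (norm (I T x))\<^sup>2"
    using decomposition[OF T] unfolding drift_integral_def[symmetric] finite_variation_def[symmetric]
    by eventually_elim (simp add: power2_norm_eq_inner inner_simps inner_commute)
  then have "(\<integral>x. (norm (U T x))\<^sup>2 \<partial>M) = (\<integral>x. (norm (finite_variation T x))\<^sup>2 + 2 * (finite_variation T x \<bullet> I T x) + (norm (I T x))\<^sup>2 \<partial>M)"
    using U_L2[OF T, THEN L2_measurable] finite_variation_L2[OF T, THEN L2_measurable] I_L2[OF T, THEN L2_measurable]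
    by (intro integral_cong_AE) auto
  also have "\<dots> = (\<integral>x. (norm (finite_variation T x))\<^sup>2 \<partial>M) + 2 * (\<integral>x. finite_variation T x \<bullet> I T x \<partial>M) + (\<integral>x. (norm (I T x))\<^sup>2 \<partial>M)"
    using L2_integrable[OF finite_variation_L2[OF T]] L2_inner[OF finite_variation_L2[OF T] I_L2[OF T]] L2_integrable[OF I_L2[OF T]] by simp
  also have "(\<integral>x. (norm (I T x))\<^sup>2 \<partial>M) = (\<integral>r. (\<integral>x. (norm (g r x))\<^sup>2 \<partial>M) \<partial>leb T)"
    using ito_isometry[OF ito[OF T]] P.integral_fst[OF gg] by (simp add: time_space_def split_beta')
  also have "(\<integral>x. (norm (finite_variation T x))\<^sup>2 \<partial>M) + 2 * (\<integral>x. finite_variation T x \<bullet> I T x \<partial>M) + \<dots> =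
    (\<integral>x. (norm (U 0 x))\<^sup>2 \<partial>M) + (\<integral>r. 2 * (\<integral>x. a r x \<bullet> finite_variation r x \<partial>M) + 2 * (\<integral>x. a r x \<bullet> I T x \<partial>M)
      + (\<integral>x. (norm (g r x))\<^sup>2 \<partial>M) \<partial>leb T)"
    unfolding finite_variation_second_moment[OF T] finite_variation_I_moment[OF T] using i by simp
  also have "(\<integral>r. 2 * (\<integral>x. a r x \<bullet> finite_variation r x \<partial>M) + 2 * (\<integral>x. a r x \<bullet> I T x \<partial>M)
      + (\<integral>x. (norm (g r x))\<^sup>2 \<partial>M) \<partial>leb T) = (\<integral>r. moment_rate r \<partial>leb T)"
  proof (rule integral_cong_AE)
    show "AE r in leb T. 2 * (\<integral>x. a r x \<bullet> finite_variation r x \<partial>M) + 2 * (\<integral>x. a r x \<bullet> I T x \<partial>M)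
      + (\<integral>x. (norm (g r x))\<^sup>2 \<partial>M) = moment_rate r"
      using AE_L2_slice[OF drift_L2_time[OF T]] AE_space[of "leb T"]
    proof eventually_elim
      case (elim r)
      then have r: "0 \<le> r" "r \<le> T" by (auto simp: space_restrict_space)
      \<comment> \<open>\<open>a r\<close> is known at time \<open>r\<close> and, for almost every
        \<open>r\<close>, square integrable, so it is a valid test variable.\<close>
      have "(\<integral>x. a r x \<bullet> I T x \<partial>M) = (\<integral>x. a r x \<bullet> I r x \<partial>M)"
        by (rule ito_martingale[OF ito[OF T] ito[OF r(1)] r drift_adapted[OF r(1)] elim(1)])
      moreover have "(\<integral>x. a r x \<bullet> U r x \<partial>M) = (\<integral>x. a r x \<bullet> finite_variation r x + a r x \<bullet> I r x \<partial>M)"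
      proof (rule integral_cong_AE)
        show "AE x in M. a r x \<bullet> U r x = a r x \<bullet> finite_variation r x + a r x \<bullet> I r x"
          using decomposition[OF r(1)] unfolding drift_integral_def[symmetric] finite_variation_def[symmetric]
          by eventually_elim (simp add: inner_simps)
      qed (use elim(1) U_L2[OF r(1)] finite_variation_L2[OF r(1)] I_L2[OF r(1)] in
          \<open>auto intro!: borel_measurable_integrable L2_inner borel_measurable_add\<close>)
      ultimately show ?case
        using L2_inner[OF elim(1) finite_variation_L2[OF r(1)]] L2_inner[OF elim(1) I_L2[OF r(1)]]
        by (simp add: moment_rate_def)
    qed
  qed (use i borel_measurable_integrable[OF moment_rate_integrable[OF T]] in auto)
  finally show ?thesis .
qed

text \<open>The rate is bounded only for almost every time, so the argument uses the integrated
  identity and takes no derivative of the moment. Monotonicity bounds the moment on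
  \<open>[0,T]\<close> below by its final value, which gives decay of order
  \<open>1 / T\<close>.\<close>

lemma second_moment_decay:
  assumes c: "0 < c"
    and diss: "\<And>t x. 0 \<le> t \<Longrightarrow> x \<in> space M \<Longrightarrow> 2 * (a t x \<bullet> U t x) + (norm (g t x))\<^sup>2 \<le> - c * (norm (U t x))\<^sup>2"
  shows "((\<lambda>t. msq M (U t)) \<longlongrightarrow> 0) at_top"
proof -
  define \<phi> where "\<phi> t = (\<integral>x. (norm (U t x))\<^sup>2 \<partial>M)" for t
  have \<phi>0: "0 \<le> \<phi> t" for t by (simp add: \<phi>_def)
  have rate: "AE r in leb T. moment_rate r \<le> - c * \<phi> r" if T: "0 \<le> T" for T
    using AE_L2_slice[OF drift_L2_time[OF T]] AE_L2_slice[OF noise_L2_time[OF T]] AE_space[of "leb T"]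
  proof eventually_elim
    case (elim r)
    then have r: "0 \<le> r" by (auto simp: space_restrict_space)
    note i = L2_inner[OF elim(1) U_L2[OF r]] L2_integrable[OF elim(2)] L2_integrable[OF U_L2[OF r]]
    have "moment_rate r = (\<integral>x. 2 * (a r x \<bullet> U r x) + (norm (g r x))\<^sup>2 \<partial>M)"
      unfolding moment_rate_def using i by simp
    also have "\<dots> \<le> (\<integral>x. - c * (norm (U r x))\<^sup>2 \<partial>M)"
      using i diss[OF r] by (intro integral_mono) auto
    also have "\<dots> = - c * \<phi> r" by (simp add: \<phi>_def)
    finally show ?case .
  qed
  have sm: "\<phi> T = \<phi> 0 + (\<integral>r. moment_rate r \<partial>leb T)" if "0 \<le> T" for T
    unfolding \<phi>_def by (rule second_moment[OF that])
  have mono: "\<phi> t \<le> \<phi> s" if st: "0 \<le> s" "s \<le> t" for s t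
  proof -
    have t: "0 \<le> t" using st by simp
    \<comment> \<open>Over the common measure \<open>lborel\<close> the integrals up to
      \<open>s\<close> and up to \<open>t\<close> can be compared pointwise.\<close>
    have eq: "(\<integral>r. moment_rate r \<partial>leb T) = (\<integral>r. indicator {0..T} r * moment_rate r \<partial>lborel)" for T
      by (simp add: integral_restrict_space)
    have "(\<integral>r. moment_rate r \<partial>leb t) \<le> (\<integral>r. moment_rate r \<partial>leb s)"
      unfolding eq
    proof (rule integral_mono_AE)
      show "integrable lborel (\<lambda>r. indicator {0..t} r * moment_rate r)"
        using moment_rate_integrable[OF t] by (simp add: integrable_restrict_space)
      show "integrable lborel (\<lambda>r. indicator {0..s} r * moment_rate r)"
        using moment_rate_integrable[OF st(1)] by (simp add: integrable_restrict_space)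
      have "AE r in lborel. r \<in> {0..t} \<longrightarrow> moment_rate r \<le> - c * \<phi> r"
        using rate[OF t] by (simp add: AE_restrict_space_iff)
      then show "AE r in lborel. indicator {0..t} r * moment_rate r \<le> indicator {0..s} r * moment_rate r"
      proof eventually_elim
        case (elim r)
        have "r \<in> {0..t} \<Longrightarrow> moment_rate r \<le> 0"
          using elim mult_nonneg_nonneg[OF less_imp_le[OF c] \<phi>0[of r]] by auto
        then show ?case using st by (auto simp: indicator_def)
      qed
    qed
    then show ?thesis using sm[OF st(1)] sm[OF t] by simp
  qed
  have bound: "\<phi> T \<le> \<phi> 0 / (c * T)" if T: "0 < T" for T
  proof -
    interpret finite_measure "leb T" by (rule finite_measure_restrict_lborel)
    have "(\<integral>r. moment_rate r \<partial>leb T) \<le> (\<integral>r. - c * \<phi> T \<partial>leb T)"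
    proof (rule integral_mono_AE)
      show "AE r in leb T. moment_rate r \<le> - c * \<phi> T"
        using rate[OF less_imp_le[OF T]] AE_space[of "leb T"]
      proof eventually_elim
        case (elim r)
        then have "\<phi> T \<le> \<phi> r" by (intro mono) (auto simp: space_restrict_space)
        then have "c * \<phi> T \<le> c * \<phi> r" using c by simp
        with elim show ?case by simp
      qed
    qed (use T moment_rate_integrable in auto)
    also have "\<dots> = - (c * T * \<phi> T)"
      using T by (simp add: measure_restrict_space space_restrict_space)
    finally have "c * T * \<phi> T \<le> \<phi> 0"
      using sm[of T] T \<phi>0[of T] by simp
    then show ?thesis using c T by (simp add: field_simps)
  qed
  have "(\<phi> \<longlongrightarrow> 0) at_top"
  proof (rule tendsto_sandwich[OF _ _ tendsto_const])
    show "\<forall>\<^sub>F T in at_top. \<phi> T \<le> \<phi> 0 / (c * T)"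
      using eventually_gt_at_top[of 0] by eventually_elim (rule bound)
    show "((\<lambda>T. \<phi> 0 / (c * T)) \<longlongrightarrow> 0) at_top"
      by (intro tendsto_divide_0[OF tendsto_const] filterlim_at_top_imp_at_infinity
          filterlim_tendsto_pos_mult_at_top[OF tendsto_const c] filterlim_ident)
  qed (use \<phi>0 in auto)
  then have "((\<lambda>t. ennreal (\<phi> t)) \<longlongrightarrow> 0) at_top"
    using tendsto_ennrealI by fastforce
  moreover have "\<forall>\<^sub>F t in at_top. ennreal (\<phi> t) = msq M (U t)"
    using eventually_ge_at_top[of 0] by eventually_elim (simp add: msq_eq U_L2 \<phi>_def)
  ultimately show ?thesis by (rule Lim_transform_eventually)
qed

end

section \<open>Lyapunov function of a wave\<close>

lemma bounded_linear_matrix_vector_complex: "bounded_linear ((*v) (A :: complex^'n^'m))"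
proof (rule linear_conv_bounded_linear[THEN iffD1])
  show "linear ((*v) A)"
    by (rule linearI)
      (auto simp: matrix_vector_mult_def vec_eq_iff sum.distrib scaleR_sum_right algebra_simps)
qed

lemma norm_complex2: "(norm (u :: complex^2))\<^sup>2 = (norm (u$1))\<^sup>2 + (norm (u$2))\<^sup>2"
  by (simp add: norm_vec_def L2_set_def sum_2)

lemma inner_complex2: "(u :: complex^2) \<bullet> w = u$1 \<bullet> w$1 + u$2 \<bullet> w$2"
  by (simp add: inner_vec_def sum_2)

lemma mat2_mult_vec:
  "((vector [vector [a, b], vector [c, d]] :: complex^2^2) *v u) = (vector [a * u$1 + b * u$2, c * u$1 + d * u$2] :: complex^2)"
  by (simp add: vec_eq_iff forall_2 matrix_vector_mult_def sum_2)

text \<open>A bounded linear map commutes with both integrals, so the image of a solution is an Ito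
  process. The Lyapunov form becomes the plain squared norm of such an image.\<close>

lemma (in wiener_process) linear_sde_ito_process:
  fixes f :: "complex^2 \<Rightarrow> 'c::euclidean_space"
  assumes sol: "linear_sde_solution M F W A B U" and f: "bounded_linear f"
  obtains I where "ito_process M F W (\<lambda>t x. f (U t x)) (\<lambda>t x. f (A *v U t x)) (\<lambda>t x. f (B *v U t x)) I"
proof -
  interpret f: bounded_linear f by fact
  have Uc: "AE x in M. continuous_on {0..} (\<lambda>t. U t x)"
    and Us: "\<And>T. 0 \<le> T \<Longrightarrow> square_integrable_adapted M F T U"
    and "\<forall>t\<in>{0..}. \<exists>I. is_ito_integral M F W t (\<lambda>r x. B *v U r x) I \<and>
        (AE x in M. U t x = U 0 x + (LINT r:{0..t}|lborel. A *v U r x) + I x)"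
    using sol by (auto simp: linear_sde_solution_def)
  then obtain I where I: "\<And>t. 0 \<le> t \<Longrightarrow> is_ito_integral M F W t (\<lambda>r x. B *v U r x) (I t)"
    and eq: "\<And>t. 0 \<le> t \<Longrightarrow> AE x in M. U t x = U 0 x + (LINT r:{0..t}|lborel. A *v U r x) + I t x"
    by (auto simp: bchoice_iff)
  note bl = bounded_linear_matrix_vector_complex[of A]
  note fA = bounded_linear_compose[OF f bl]
  have cA: "continuous_on {0..} (\<lambda>t. A *v U t x)" if "continuous_on {0..} (\<lambda>t. U t x)" for x
    by (rule bounded_linear.continuous_on[OF bl that])
  show thesis
  proof (rule that[of "\<lambda>t x. f (I t x)"], unfold_locales)
    show "AE x in M. continuous_on {0..} (\<lambda>t. f (A *v U t x))"
      using Uc by eventually_elim (rule bounded_linear.continuous_on[OF f cA])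
    show "AE x in M. f (U t x) = f (U 0 x) + (LINT r:{0..t}|lborel. f (A *v U r x)) + f (I t x)" if "0 \<le> t" for t
      using eq[OF that] Uc
    proof eventually_elim
      case (elim x)
      \<comment> \<open>Continuity of the path makes the drift integrable, so that \<open>f\<close>
        may be moved under the integral.\<close>
      have "set_integrable lborel {0..t} (\<lambda>r. A *v U r x)"
        by (rule borel_integrable_atLeastAtMost'[OF continuous_on_subset[OF cA[OF elim(2)]]]) auto
      then have "f (LINT r:{0..t}|lborel. A *v U r x) = (LINT r:{0..t}|lborel. f (A *v U r x))"
        unfolding set_integrable_def set_lebesgue_integral_def
        by (subst integral_bounded_linear[OF f, symmetric]) (simp_all add: f.scaleR)
      then show ?case by (subst elim(1)) (simp add: f.add)
    qed
  qed (auto intro: square_integrable_adapted_bounded_linear[OF f] square_integrable_adapted_bounded_linear[OF fA]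
      is_ito_integral_bounded_linear[OF f] Us I)
qed

text \<open>The drift part of the generator in real coordinates, indices \<open>1\<close> and
  \<open>2\<close> marking real and imaginary parts. With \<open>b = \<beta> * k\<close>, the
  hypotheses say that \<open>q = k + p * cnj z / \<beta>\<close>, which cancels the mixed
  terms.\<close>

lemma Lyapunov_identity:
  fixes \<beta> :: real
  assumes "b = \<beta> * q1 - p * z1" and "p * z2 = - \<beta> * q2"
  shows "2 * ((p - q1\<^sup>2 - q2\<^sup>2) * ((z1 * v1 - z2 * v2) * s1 + (z1 * v2 + z2 * v1) * s2)
    + ((b * s1 - \<beta> * v1 + (q1 * z1 - q2 * z2) * v1 - (q1 * z2 + q2 * z1) * v2) * (v1 + q1 * s1 - q2 * s2)
    + (b * s2 - \<beta> * v2 + (q1 * z1 - q2 * z2) * v2 + (q1 * z2 + q2 * z1) * v1) * (v2 + q1 * s2 + q2 * s1)))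
    = 2 * b * q1 * (s1\<^sup>2 + s2\<^sup>2) + 2 * (q1 * z1 - q2 * z2 - \<beta>) * (v1\<^sup>2 + v2\<^sup>2)"
  using assms by algebra

text \<open>Here \<open>z\<close> stands for
  \<open>exp (- (\<i> * complex_of_real \<omega>)) - 1\<close>, of which only its place on the unit
  circle about \<open>-1\<close> and \<open>z \<noteq> 0\<close> matter.\<close>

lemma wave_stable:
  fixes \<beta> k \<gamma> :: real and z :: complex
  assumes W: "wiener_process M F W" and \<beta>: "0 < \<beta>" and k: "0 < k"
    and z: "norm (z + 1) = 1" "z \<noteq> 0" and \<gamma>: "\<gamma>\<^sup>2 \<le> k * (\<beta> - 2 * k) / \<beta>"
  shows "linear_mean_square_stable M F W
    (vector [vector [0, z], vector [complex_of_real (\<beta> * k), complex_of_real (- \<beta>)]])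
    (vector [vector [0, 0], vector [0, complex_of_real \<gamma>]])"
  unfolding linear_mean_square_stable_def
proof (intro allI impI)
  let ?A = "vector [vector [0, z], vector [complex_of_real (\<beta> * k), complex_of_real (- \<beta>)]] :: complex^2^2"
  let ?B = "vector [vector [0, 0], vector [0, complex_of_real \<gamma>]] :: complex^2^2"
  fix U assume sol: "linear_sde_solution M F W ?A ?B U"
  interpret wiener_process M F W by fact
  define u where "u = - Re z"
  define y where "y = Im z"
  have "(Re z + 1)\<^sup>2 + (Im z)\<^sup>2 = 1" using cmod_power2[of "z + 1"] z(1) by simp
  then have uy: "y\<^sup>2 = 2 * u - u\<^sup>2"
    by (simp add: u_def y_def power2_eq_square algebra_simps)
  then have y2: "y\<^sup>2 = u * (2 - u)" by (simp add: power2_eq_square algebra_simps)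
  have "u \<noteq> 0"
    using z(2) uy by (auto simp: u_def y_def complex_eq_iff)
  moreover have "0 \<le> u * (2 - u)" using zero_le_power2[of y] unfolding uy by (simp add: power2_eq_square algebra_simps)
  ultimately have u: "0 < u" "u \<le> 2" by (auto simp: zero_le_mult_iff)
  have "0 \<le> k * (\<beta> - 2 * k)"
    using order_trans[OF zero_le_power2 \<gamma>] \<beta> by (simp add: zero_le_divide_iff)
  then have \<beta>k: "2 * k \<le> \<beta>" using k by (simp add: zero_le_mult_iff)
  \<comment> \<open>\<open>\<epsilon>\<close> is the excess of \<open>m = p u\<close> over its critical value \<open>\<beta> k\<close>. Negativity of the \<open>|v|\<^sup>2\<close> coefficient and
    positivity of the form bound it from above.\<close>
  define \<epsilon> where "\<epsilon> = \<beta> * k * u / 4"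
  have \<epsilon>: "0 < \<epsilon>" "\<epsilon> \<le> \<beta> * k / 2"
    using \<beta> k u by (auto simp: \<epsilon>_def field_simps)
  define m where "m = \<beta> * k + \<epsilon>"
  define p where "p = m / u"
  \<comment> \<open>\<open>q1\<close> and \<open>q2\<close> are the real and imaginary parts of
    \<open>k + p * cnj z / \<beta>\<close>; the real part simplifies because
    \<open>p * u = \<beta> * k + \<epsilon>\<close>.\<close>
  define q1 where "q1 = - \<epsilon> / \<beta>"
  define q2 where "q2 = - p * y / \<beta>"
  have m: "\<beta> * k \<le> m" "0 < m" using \<epsilon> \<beta> k by (auto simp: m_def add_pos_pos)
  have h1: "\<beta> * k = \<beta> * q1 - p * (- u)" and h2: "p * y = - \<beta> * q2"
    using \<beta> u by (auto simp: q1_def q2_def p_def m_def field_simps)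
  \<comment> \<open>This is positive definiteness of the form. After multiplication by
    \<open>u * \<beta>\<^sup>2\<close> it compares
    \<open>m * (\<beta>\<^sup>2 - m * (2 - u))\<close> with
    \<open>u * \<epsilon>\<^sup>2\<close>.\<close>
  have "0 < p - q1\<^sup>2 - q2\<^sup>2"
  proof -
    have q2': "q2\<^sup>2 = m\<^sup>2 * (2 - u) / (u * \<beta>\<^sup>2)"
    proof -
      have "p\<^sup>2 * y\<^sup>2 = m\<^sup>2 * (2 - u) / u" using u unfolding y2 by (simp add: p_def power2_eq_square)
      moreover have "q2\<^sup>2 = p\<^sup>2 * y\<^sup>2 / \<beta>\<^sup>2" by (simp add: q2_def power_divide power_mult_distrib)
      ultimately show ?thesis by simp
    qed
    \<comment> \<open>Since \<open>2 * k \<le> \<beta>\<close>, the right-hand side is at least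
      \<open>\<beta> * k * u - 2 * \<epsilon>\<close>, and \<open>2 * \<epsilon>\<close> is half of
      \<open>\<beta> * k * u\<close>.\<close>
    have "\<beta> * k * u / 2 \<le> \<beta>\<^sup>2 - m * (2 - u)"
    proof -
      have "\<beta> * (2 * k) \<le> \<beta> * \<beta>" using \<beta>k \<beta> by simp
      moreover have "0 \<le> \<epsilon> * u" using \<epsilon> u by simp
      ultimately show ?thesis
        by (simp add: m_def power2_eq_square algebra_simps) (simp add: \<epsilon>_def field_simps)
    qed
    then have "m * (\<beta> * k * u / 2) \<le> m * (\<beta>\<^sup>2 - m * (2 - u))" using m(2) by simp
    moreover have "(\<beta> * k) * (\<beta> * k * u / 2) \<le> m * (\<beta> * k * u / 2)"
      using m \<beta> k u by (intro mult_right_mono) auto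
    moreover have "u * \<epsilon>\<^sup>2 < (\<beta> * k) * (\<beta> * k * u / 2)"
    proof -
      have "\<epsilon>\<^sup>2 \<le> (\<beta> * k / 2)\<^sup>2" using \<epsilon> by (intro power_mono) auto
      also have "\<dots> < (\<beta> * k)\<^sup>2 / 2" using \<beta> k by (simp add: power_divide)
      finally show ?thesis using u by (simp add: power2_eq_square field_simps)
    qed
    ultimately have "u * \<epsilon>\<^sup>2 < m * (\<beta>\<^sup>2 - m * (2 - u))" by linarith
    moreover have "p - q1\<^sup>2 - q2\<^sup>2 = (m * (\<beta>\<^sup>2 - m * (2 - u)) - u * \<epsilon>\<^sup>2) / (u * \<beta>\<^sup>2)"
      unfolding q2' using u \<beta> by (simp add: p_def q1_def power2_eq_square field_simps)
    ultimately show ?thesis using u \<beta> by simp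
  qed
  then obtain \<kappa> where \<kappa>: "0 < \<kappa>" "\<kappa>\<^sup>2 = p - q1\<^sup>2 - q2\<^sup>2"
    by (metis less_imp_le real_sqrt_gt_zero real_sqrt_pow2)
  \<comment> \<open>Completing the square in \<open>v\<close>: the form is
    \<open>\<kappa>\<^sup>2\<close> times the squared modulus of \<open>s\<close> plus the squared
    modulus of \<open>q * s + v\<close>, so it is the squared norm of \<open>L *v w\<close>.
    \<open>R\<close> inverts \<open>L\<close>.\<close>
  define L :: "complex^2^2" where "L = vector [vector [complex_of_real \<kappa>, 0], vector [Complex q1 q2, 1]]"
  define R :: "complex^2^2" where
    "R = vector [vector [1 / complex_of_real \<kappa>, 0], vector [- Complex q1 q2 / complex_of_real \<kappa>, 1]]"
  have RL: "R *v (L *v w) = w" for w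
    using \<kappa>(1) by (simp add: L_def R_def mat2_mult_vec vec_eq_iff forall_2)
  note blL = bounded_linear_matrix_vector_complex[of L]
  obtain C where C: "0 < C" "norm (L *v w) \<le> norm w * C" for w
    using bounded_linear.pos_bounded[OF blL] by auto
  \<comment> \<open>The smaller of the decay rates found below for the coefficients of the two
    squared moduli.\<close>
  define \<delta> where "\<delta> = min (2 * k * \<epsilon>) (k * u)"
  have \<delta>: "0 < \<delta>" using k \<epsilon> u by (simp add: \<delta>_def)
  have diss: "2 * ((L *v (?A *v w)) \<bullet> (L *v w)) + (norm (L *v (?B *v w)))\<^sup>2 \<le> - (\<delta> / C\<^sup>2) * (norm (L *v w))\<^sup>2" for w
  proof -
    define s where "s = w$1"
    define v where "v = w$2"
    have "2 * ((L *v (?A *v w)) \<bullet> (L *v w)) = 2 * ((p - q1\<^sup>2 - q2\<^sup>2) * ((- u * Re v - y * Im v) * Re s + (- u * Im v + y * Re v) * Im s)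
    + ((\<beta> * k * Re s - \<beta> * Re v + (q1 * - u - q2 * y) * Re v - (q1 * y + q2 * - u) * Im v) * (Re v + q1 * Re s - q2 * Im s)
    + (\<beta> * k * Im s - \<beta> * Im v + (q1 * - u - q2 * y) * Im v + (q1 * y + q2 * - u) * Re v) * (Im v + q1 * Im s + q2 * Re s)))"
      unfolding \<kappa>(2)[symmetric]
      by (simp add: L_def mat2_mult_vec inner_complex2 inner_complex_def s_def v_def u_def y_def power2_eq_square algebra_simps)
    also have "\<dots> = 2 * (\<beta> * k) * q1 * ((Re s)\<^sup>2 + (Im s)\<^sup>2) + 2 * (q1 * - u - q2 * y - \<beta>) * ((Re v)\<^sup>2 + (Im v)\<^sup>2)"
      by (rule Lyapunov_identity[OF h1 h2])
    also have "\<dots> = - 2 * k * \<epsilon> * (norm s)\<^sup>2 + 2 * (q1 * - u - q2 * y - \<beta>) * (norm v)\<^sup>2"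
      using \<beta> by (simp add: q1_def cmod_power2)
    finally have 1: "2 * ((L *v (?A *v w)) \<bullet> (L *v w)) =
      - 2 * k * \<epsilon> * (norm s)\<^sup>2 + 2 * (q1 * - u - q2 * y - \<beta>) * (norm v)\<^sup>2" .
    \<comment> \<open>The noise acts on the speed only, and \<open>L\<close> leaves a vector with
      vanishing first component unchanged.\<close>
    have 2: "(norm (L *v (?B *v w)))\<^sup>2 = \<gamma>\<^sup>2 * (norm v)\<^sup>2"
      by (simp add: L_def mat2_mult_vec norm_complex2 v_def norm_mult power_mult_distrib)
    \<comment> \<open>The bound stays strictly negative even when equality holds in the condition on
      \<open>\<gamma>\<close>, because \<open>u\<close> is positive.\<close>
    have 3: "2 * (q1 * - u - q2 * y - \<beta>) + \<gamma>\<^sup>2 \<le> - k * u"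
    proof -
      have "- (q2 * y) = m * (2 - u) / \<beta>"
      proof -
        have "- (q2 * y) = p * y\<^sup>2 / \<beta>" by (simp add: q2_def power2_eq_square)
        moreover have "p * y\<^sup>2 = m * (2 - u)" using u by (simp add: y2 p_def)
        ultimately show ?thesis by simp
      qed
      then have "2 * (q1 * - u - q2 * y - \<beta>) = 2 * (\<epsilon> * u / \<beta> + m * (2 - u) / \<beta> - \<beta>)"
        by (simp add: q1_def)
      also have "\<dots> = 2 * (2 * k - \<beta>) - 2 * k * u + 4 * \<epsilon> / \<beta>"
        using \<beta> by (simp add: m_def field_simps)
      \<comment> \<open>The choice of \<epsilon> gives back exactly half of the gain
        \<open>2 * k * u\<close>.\<close>
      also have "4 * \<epsilon> / \<beta> = k * u" using \<beta> by (simp add: \<epsilon>_def)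
      finally have "2 * (q1 * - u - q2 * y - \<beta>) = 2 * (2 * k - \<beta>) - k * u" by simp
      \<comment> \<open>As \<open>k \<le> 2 * \<beta>\<close>, the hypothesis on \<gamma> is
        absorbed by the term \<open>2 * (2 * k - \<beta>)\<close>.\<close>
      moreover have "k * (\<beta> - 2 * k) / \<beta> \<le> 2 * (\<beta> - 2 * k)"
      proof -
        have "k * (\<beta> - 2 * k) \<le> (2 * \<beta>) * (\<beta> - 2 * k)"
          using \<beta>k k by (intro mult_right_mono) auto
        then show ?thesis using \<beta> by (simp add: field_simps)
      qed
      ultimately show ?thesis using \<gamma> by simp
    qed
    have "2 * ((L *v (?A *v w)) \<bullet> (L *v w)) + (norm (L *v (?B *v w)))\<^sup>2
      = - (2 * k * \<epsilon>) * (norm s)\<^sup>2 + (2 * (q1 * - u - q2 * y - \<beta>) + \<gamma>\<^sup>2) * (norm v)\<^sup>2"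
      unfolding 1 2 by (simp add: algebra_simps)
    also have "\<dots> \<le> - \<delta> * (norm s)\<^sup>2 + - \<delta> * (norm v)\<^sup>2"
      using 3 by (intro add_mono mult_right_mono) (auto simp: \<delta>_def)
    also have "\<dots> = - \<delta> * (norm w)\<^sup>2"
      by (simp add: norm_complex2 s_def v_def algebra_simps)
    also have "\<dots> \<le> - (\<delta> / C\<^sup>2) * (norm (L *v w))\<^sup>2"
    proof -
      have "(norm (L *v w))\<^sup>2 \<le> C\<^sup>2 * (norm w)\<^sup>2"
        using power_mono[OF C(2)[of w] norm_ge_zero, of 2] by (simp add: power_mult_distrib mult.commute)
      then show ?thesis using \<delta> C(1) by (simp add: field_simps)
    qed
    finally show ?thesis .
  qed
  obtain I where "ito_process M F W (\<lambda>t x. L *v U t x) (\<lambda>t x. L *v (?A *v U t x)) (\<lambda>t x. L *v (?B *v U t x)) I"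
    using linear_sde_ito_process[OF sol blL] by blast
  then interpret P: ito_process M F W "\<lambda>t x. L *v U t x" "\<lambda>t x. L *v (?A *v U t x)" "\<lambda>t x. L *v (?B *v U t x)" I .
  have lim: "((\<lambda>t. msq M (\<lambda>x. L *v U t x)) \<longlongrightarrow> 0) at_top"
    using \<delta> C(1) diss by (intro P.second_moment_decay[of "\<delta> / C\<^sup>2"]) auto
  \<comment> \<open>Decay is now known for \<open>L *v U t x\<close>; the inverse \<open>R\<close>
    carries it back to \<open>U t x\<close>.\<close>
  obtain K where K: "\<And>N w. w \<in> borel_measurable N \<Longrightarrow> msq N (\<lambda>x :: 'a. R *v w x) \<le> ennreal K * msq N w"
    using msq_bounded_linear_le[OF bounded_linear_matrix_vector_complex[of R]] by metis
  have "((\<lambda>t. msq M (U t)) \<longlongrightarrow> 0) at_top"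
  proof (rule tendsto_sandwich[OF _ _ tendsto_const])
    show "\<forall>\<^sub>F t in at_top. msq M (U t) \<le> ennreal K * msq M (\<lambda>x. L *v U t x)"
      using eventually_ge_at_top[of 0]
      by eventually_elim (use K[OF P.U_measurable] RL in auto)
    show "((\<lambda>t. ennreal K * msq M (\<lambda>x. L *v U t x)) \<longlongrightarrow> 0) at_top"
      using ennreal_tendsto_cmult[OF _ lim, of "ennreal K"] by simp
  qed auto
  then show "((\<lambda>t. \<integral>\<^sup>+ x. ennreal ((norm (U t x))\<^sup>2) \<partial>M) \<longlongrightarrow> 0) at_top"
    by (simp add: msq_def)
qed

section \<open>The optimal velocity model\<close>

lemma deriv_V_op_pos:
  assumes "0 < v0" "0 < sc"
  shows "0 < deriv (V_op v0 sc \<alpha>) s"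
proof -
  have "(V_op v0 sc \<alpha> has_real_derivative v0 / 2 * ((1 - (tanh (s / sc - \<alpha>))\<^sup>2) * (1 / sc))) (at s)"
    unfolding V_op_def using assms by (auto intro!: derivative_eq_intros)
  moreover have "(tanh (s / sc - \<alpha>))\<^sup>2 < 1"
    by (simp add: abs_square_less_1 abs_less_iff minus_less_iff tanh_real_lt_1 tanh_real_gt_neg1)
  ultimately show ?thesis
    using assms by (simp add: DERIV_imp_deriv)
qed

theorem theorem3:
  fixes M :: "'a measure" and F :: "real \<Rightarrow> 'a measure" and W :: "real \<Rightarrow> 'a \<Rightarrow> real"
    and \<beta> v0 sc \<alpha> \<sigma>0 se ve :: real
  assumes "wiener_process M F W"
    and "\<beta> > 0" and "v0 > 0" and "sc > 0" and "\<sigma>0 \<ge> 0" and "se > 0"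
    and "ve = V_op v0 sc \<alpha> se" and "ve > 0"
    and "\<sigma>0\<^sup>2 \<le> 4 * ve * deriv (V_op v0 sc \<alpha>) se / \<beta> * (\<beta> - 2 * deriv (V_op v0 sc \<alpha>) se)"
  shows "mean_square_stable M F W (acceleration \<beta> v0 sc \<alpha>) (noise_amplitude \<sigma>0) se ve"
  unfolding mean_square_stable_def
proof (intro allI impI)
  fix \<omega> assume \<omega>: "exp (\<i> * complex_of_real \<omega>) \<noteq> 1"
  have "sc \<noteq> 0" using \<open>sc > 0\<close> by simp
  have "norm (exp (- (\<i> * complex_of_real \<omega>)) - 1 + 1) = 1"
    by (simp add: norm_exp_eq_Re)
  \<comment> \<open>The exclusion of uniform shifts enters here.\<close>
  moreover have "exp (- (\<i> * complex_of_real \<omega>)) - 1 \<noteq> 0"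
    using \<omega> by (simp add: exp_minus)
  \<comment> \<open>The assumed bound divided by \<open>4 * ve\<close>, which is the condition of
    \<open>wave_stable\<close> for the linearized noise coefficient.\<close>
  moreover have "(\<sigma>0 / (2 * sqrt ve))\<^sup>2 \<le> deriv (V_op v0 sc \<alpha>) se * (\<beta> - 2 * deriv (V_op v0 sc \<alpha>) se) / \<beta>"
    using assms(9) \<open>ve > 0\<close> \<open>\<beta> > 0\<close> by (simp add: power_divide power_mult_distrib field_simps)
  ultimately show "linear_mean_square_stable M F W (drift_matrix (acceleration \<beta> v0 sc \<alpha>) se ve \<omega>)
     (noise_matrix (noise_amplitude \<sigma>0) se ve)"
    unfolding drift_matrix_acceleration[OF \<open>sc \<noteq> 0\<close>] noise_matrix_noise_amplitude[OF \<open>ve > 0\<close>]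
    by (intro wave_stable[OF assms(1,2) deriv_V_op_pos[OF assms(3,4)]])
qed

end
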